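(* Let $n\in\mathbb{N}$ and let $A=\sum_{\alpha\in\mathbb{N}_0^n}\frac{c_\alpha}{\alpha!}x^\alpha\partial^\alpha$ with $c_\alpha\in\mathbb{R}$ for all $\alpha$; thus $A$ is the diagonal operator $Ax^\alpha=a_\alpha x^\alpha$ with $a_\alpha=\sum_{\beta\preceq\alpha}\binom{\alpha}{\beta}c_\beta$. For $t\ge0$ let $e^{tA}$ be the linear operator on $\mathbb{R}[x_1,\dots,x_n]$ with $e^{tA}x^\alpha=e^{ta_\alpha}x^\alpha$. The following are equivalent: (i) for every $t\ge0$, $e^{tA}$ is a positivity preserver, i.e. maps polynomials non-negative on $\mathbb{R}^n$ to polynomials non-negative on $\mathbb{R}^n$; (ii) there exist $b=(b_1,\dots,b_n)^T\in\mathbb{R}^n$, a real symmetric positive semi-definite matrix $\Sigma=(\sigma_{i,j})_{i,j=1}^n$, and a $\sigma$-finite Borel measure $\nu$ on $\mathbb{R}^n$ with $\nu(\{0\})=0$ and $\int_{\mathbb{R}^n}|x^\alpha|\,d\nu(x)<\infty$ for all $\alpha$ with $|\alpha|\ge2$, such that ($c_0\in\mathbb{R}$ arbitrary and) $c_{e_i}=b_i+\int_{\|x\|_2\ge1}x_i\,d\nu(x)$ for $i=1,\dots,n$; $c_{e_i+e_j}=\sigma_{i,j}+\int_{\mathbb{R}^n}x^{e_i+e_j}\,d\nu(x)$ for $i,j=1,\dots,n$; $c_\alpha=\int_{\mathbb{R}^n}x^\alpha\,d\nu(x)$ for all $\alpha$ with $|\alpha|\ge3$.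
   Context: Multi-index notation: $\alpha!=\prod\alpha_i!$, $x^\alpha=\prod x_i^{\alpha_i}$, $\partial^\alpha=\prod\partial_i^{\alpha_i}$, $\beta\preceq\alpha$ means $\beta_i\le\alpha_i$ for all $i$, $\binom{\alpha}{\beta}=\prod_i\binom{\alpha_i}{\beta_i}$, and $e_i$ is the $i$-th standard unit vector. *)

theory Defs
  imports "HOL-Analysis.Analysis"
begin

text \<open>Real polynomials in the variables x_i (i ranging over the finite index type 'n),
  represented by their coefficient functions on multi-indices 'n \<Rightarrow> nat with finite support.\<close>

type_synonym 'n mindex = "'n \<Rightarrow> nat"

definition xpow :: "real^'n \<Rightarrow> ('n::finite) mindex \<Rightarrow> real" where
  "xpow x \<alpha> = (\<Prod>i\<in>UNIV. (x $ i) ^ (\<alpha> i))"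

definition is_poly :: "(('n::finite) mindex \<Rightarrow> real) \<Rightarrow> bool" where
  "is_poly p \<longleftrightarrow> finite {\<alpha>. p \<alpha> \<noteq> 0}"

definition poly_eval :: "(('n::finite) mindex \<Rightarrow> real) \<Rightarrow> real^'n \<Rightarrow> real" where
  "poly_eval p x = (\<Sum>\<alpha>\<in>{\<alpha>. p \<alpha> \<noteq> 0}. p \<alpha> * xpow x \<alpha>)"

definition nonneg_poly :: "(('n::finite) mindex \<Rightarrow> real) \<Rightarrow> bool" where
  "nonneg_poly p \<longleftrightarrow> (\<forall>x. poly_eval p x \<ge> 0)"

definition positivity_preserver ::
  "((('n::finite) mindex \<Rightarrow> real) \<Rightarrow> ('n mindex \<Rightarrow> real)) \<Rightarrow> bool" where
  "positivity_preserver T \<longleftrightarrow> (\<forall>p. is_poly p \<and> nonneg_poly p \<longrightarrow> nonneg_poly (T p))"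

definition mindex_le :: "('n::finite) mindex \<Rightarrow> 'n mindex \<Rightarrow> bool" where
  "mindex_le \<beta> \<alpha> \<longleftrightarrow> (\<forall>i. \<beta> i \<le> \<alpha> i)"

definition mbinom :: "('n::finite) mindex \<Rightarrow> 'n mindex \<Rightarrow> nat" where
  "mbinom \<alpha> \<beta> = (\<Prod>i\<in>UNIV. \<alpha> i choose \<beta> i)"

definition mabs :: "('n::finite) mindex \<Rightarrow> nat" where
  "mabs \<alpha> = (\<Sum>i\<in>UNIV. \<alpha> i)"

definition unit_idx :: "'n \<Rightarrow> 'n mindex" where
  "unit_idx i = (\<lambda>j. if j = i then 1 else 0)"

text \<open>Eigenvalues a_alpha of the diagonal operator A = sum c_alpha/alpha! x^alpha d^alpha.\<close>
definition diag_eig :: "(('n::finite) mindex \<Rightarrow> real) \<Rightarrow> 'n mindex \<Rightarrow> real" where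
  "diag_eig c \<alpha> = (\<Sum>\<beta>\<in>{\<beta>. mindex_le \<beta> \<alpha>}. real (mbinom \<alpha> \<beta>) * c \<beta>)"

definition exp_op :: "(('n::finite) mindex \<Rightarrow> real) \<Rightarrow> real \<Rightarrow>
    ('n mindex \<Rightarrow> real) \<Rightarrow> ('n mindex \<Rightarrow> real)" where
  "exp_op c t p = (\<lambda>\<alpha>. exp (t * diag_eig c \<alpha>) * p \<alpha>)"

definition psd_matrix :: "real^'n^'n \<Rightarrow> bool" where
  "psd_matrix S \<longleftrightarrow> transpose S = S \<and> (\<forall>v. v \<bullet> (S *v v) \<ge> 0)"

end

theory Submission
  imports Defs "HOL-Probability.Helly_Selection"
begin

text \<open>
  Call c conditionally positive if it is non-negative, as a functional on polynomials, at every
  non-negative q without constant and linear part. Differentiating the value of e^{tA} p at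
  (1,...,1) for p(y) = q(y - 1) at t = 0 shows that the semigroup property forces this; so does
  the Levy-Khinchin form, because a psd matrix is a sum of rank one matrices.

  Conversely, by separation in finite dimensions a conditionally positive c is, on the
  multi-indices of order between 2 and d, a limit of moments of positive combinations of point
  masses. For such a combination exp (t a) is a limit of sums of products of point evaluations,
  hence a positivity preserving multiplier, and the order at most 1 part of c only contributes a
  scaling of the coordinates. To reach the Levy-Khinchin form, weight each point mass at x by the
  square of |x| and use polar coordinates |x| in [0, \<infinity>], x / |x|; the box of these coordinates is a
  continuous image of the real line, so Helly's theorem supplies a limit measure. Its part over
  |x| = 0 yields the matrix, its part over 0 < |x| < \<infinity> yields the measure, and there is no mass at
  infinity since all moments stay bounded.
\<close>

section \<open>Approximation in convex cones\<close>

text \<open>By Taylor's formula the coefficients \<open>xpow x \<beta>\<close>, the moments of the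
  point mass at x, make A the substitution p(y) -> p((x + 1) y), taken coordinatewise. This is why
  point masses are the generators. Likewise A p at (1,...,1) is the functional c applied to the
  Taylor coefficients of p there. The cone of such moments is not closed: points of size h with
  weight of order h^-2 keep their second moments while the higher ones vanish as h tends to 0. So
  separation yields limits only, and the total weight near 0 may explode; the factor |x|^2 keeps the
  mass bounded. With \<theta> = 1 / (1 + |x|^2), infinity becomes \<theta> = 0, and a moment of
  order m becomes the integral of a bounded continuous function divided by \<theta>^(m - 2). Weak
  convergence does not control such poles; uniform bounds for every higher pole do, and they also
  exclude mass on \<theta> = 0. They hold because all moments of order at least 2 converge. The
  curve is there because Helly's theorem concerns measures on the line: a finitely supported measure
  is transported by choosing one preimage of each point, so surjectivity and continuity
  suffice.\<close>

lemma nonneg_if_quadratic_perturbation: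
  fixes a B :: real
  assumes "\<And>r. 0 < r \<Longrightarrow> r \<le> 1 \<Longrightarrow> 0 \<le> 2 * r * a + r\<^sup>2 * B"
  shows "0 \<le> a"
proof -
  \<comment> \<open>Divide by r = 1/(n + 1) and let n grow: only the first-order coefficient
    survives.\<close>
  have ev: "\<forall>\<^sub>F n in sequentially. 0 \<le> 2 * a + inverse (real (Suc n)) * B"
  proof (rule always_eventually, rule allI)
    fix n
    let ?r = "inverse (real (Suc n))"
    have "0 < ?r" "?r \<le> 1" by (auto simp: inverse_le_1_iff)
    from assms[OF this] have "0 \<le> ?r * (2 * a + ?r * B)"
      by (simp add: power2_eq_square algebra_simps)
    with \<open>0 < ?r\<close> show "0 \<le> 2 * a + ?r * B"
      by (simp add: zero_le_mult_iff del: of_nat_Suc)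
  qed
  have "(\<lambda>n. 2 * a + inverse (real (Suc n)) * B) \<longlonglongrightarrow> 2 * a + 0 * B"
    by (intro tendsto_intros LIMSEQ_inverse_real_of_nat)
  from tendsto_lowerbound[OF this ev] show ?thesis by simp
qed

text \<open>Let z be the point of the closure of \<open>C\<close> (seen on \<open>S\<close>) nearest
  to c, and q = z - c. Minimality makes q non-negative on \<open>C\<close> and <q, z> non-positive;
  the dual hypothesis gives <q, c> >= 0, so |q|^2 = <q, z> - <q, c> <= 0 and z = c. As
  \<open>C\<close> may fail to be closed, z is only a limit of elements of \<open>C\<close>.\<close>

lemma cone_approximation:
  fixes c :: "'b \<Rightarrow> real" and C :: "('b \<Rightarrow> real) set"
  assumes S: "finite S"
    and zero: "(\<lambda>_. 0) \<in> C"
    and add: "\<And>u v. u \<in> C \<Longrightarrow> v \<in> C \<Longrightarrow> (\<lambda>b. u b + v b) \<in> C"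
    and scale: "\<And>u r. u \<in> C \<Longrightarrow> 0 \<le> r \<Longrightarrow> (\<lambda>b. r * u b) \<in> C"
    and dual: "\<And>q. (\<And>u. u \<in> C \<Longrightarrow> 0 \<le> (\<Sum>b\<in>S. q b * u b)) \<Longrightarrow> 0 \<le> (\<Sum>b\<in>S. q b * c b)"
    and "0 < \<epsilon>"
  shows "\<exists>u\<in>C. \<forall>b\<in>S. \<bar>c b - u b\<bar> < \<epsilon>"
proof -
  define D where "D u = (\<Sum>b\<in>S. (c b - u b)\<^sup>2)" for u
  define \<delta> where "\<delta> = Inf (D ` C)"
  have bdd: "bdd_below (D ` C)"
    by (rule bdd_belowI[of _ 0]) (auto simp: D_def intro: sum_nonneg)
  have \<delta>_le: "\<delta> \<le> D u" if "u \<in> C" for u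
    unfolding \<delta>_def using that bdd by (intro cInf_lower) auto
  have "\<exists>u\<in>C. D u < \<delta> + inverse (real (Suc k))" for k
  proof -
    have "\<exists>y\<in>D ` C. y < \<delta> + inverse (real (Suc k))"
      using zero unfolding \<delta>_def by (intro cInf_lessD) auto
    then show ?thesis by auto
  qed
  then obtain m where mC: "m k \<in> C" and mD: "D (m k) < \<delta> + inverse (real (Suc k))" for k
    by metis
  \<comment> \<open>The parallelogram law makes the minimising sequence Cauchy.\<close>
  have gap: "(m k b - m l b)\<^sup>2 \<le> 2 * inverse (real (Suc k)) + 2 * inverse (real (Suc l))"
    if "b \<in> S" for k l b
  proof -
    let ?h = "\<lambda>b. 1/2 * (m k b + m l b)"
    have "?h \<in> C" using scale[OF add[OF mC mC], of "1/2"] by simp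
    then have "\<delta> \<le> D ?h" by (rule \<delta>_le)
    have "(m k b - m l b)\<^sup>2 \<le> (\<Sum>b\<in>S. (m k b - m l b)\<^sup>2)"
      using S that by (intro member_le_sum) auto
    also have "\<dots> = 2 * D (m k) + 2 * D (m l) - 4 * D ?h"
      unfolding D_def sum_distrib_left sum.distrib[symmetric] sum_subtractf[symmetric]
      by (intro sum.cong refl) (simp add: power2_eq_square field_simps)
    finally show ?thesis using \<open>\<delta> \<le> D ?h\<close> mD[of k] mD[of l] by linarith
  qed
  have "Cauchy (\<lambda>k. m k b)" if "b \<in> S" for b
  proof (rule metric_CauchyI)
    fix e :: real assume "0 < e"
    obtain N where N: "inverse (real (Suc N)) < e\<^sup>2 / 4"
      using reals_Archimedean[of "e\<^sup>2/4"] \<open>0 < e\<close> by auto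
    have "dist (m k b) (m l b) < e" if "k \<ge> N" "l \<ge> N" for k l
    proof -
      have "inverse (real (Suc k)) \<le> inverse (real (Suc N))"
           "inverse (real (Suc l)) \<le> inverse (real (Suc N))"
        using that by (auto simp: field_simps)
      then have "(m k b - m l b)\<^sup>2 < e\<^sup>2" using gap[OF \<open>b \<in> S\<close>, of k l] N by linarith
      then show ?thesis using \<open>0 < e\<close> power2_less_imp_less[of "\<bar>m k b - m l b\<bar>" e]
        by (simp add: dist_real_def)
    qed
    then show "\<exists>M. \<forall>k\<ge>M. \<forall>l\<ge>M. dist (m k b) (m l b) < e" by blast
  qed
  then have "\<exists>z. (\<lambda>k. m k b) \<longlonglongrightarrow> z" if "b \<in> S" for b
    using that Cauchy_convergent_iff convergent_def by blast
  then obtain z where z: "(\<lambda>k. m k b) \<longlonglongrightarrow> z b" if "b \<in> S" for b by metis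
  define q where "q b = z b - c b" for b
  have Dz_le: "D z \<le> \<delta>"
  proof (rule tendsto_le[of sequentially])
    show "(\<lambda>k. D (m k)) \<longlonglongrightarrow> D z" unfolding D_def by (intro tendsto_intros z)
    have "(\<lambda>k. \<delta> + inverse (real (Suc k))) \<longlonglongrightarrow> \<delta> + 0"
      by (intro tendsto_intros LIMSEQ_inverse_real_of_nat)
    then show "(\<lambda>k. \<delta> + inverse (real (Suc k))) \<longlonglongrightarrow> \<delta>" by simp
  qed (use mD in \<open>auto intro!: always_eventually less_imp_le\<close>)
  \<comment> \<open>z itself need not lie in \<open>C\<close>; minimality is inherited because s (m
    k) + r u lies in \<open>C\<close> for every k.\<close>
  have shift: "D z \<le> D (\<lambda>b. s * z b + r * u b)" if "u \<in> C" "0 \<le> s" "0 \<le> r" for u s r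
  proof -
    have "(\<lambda>k. D (\<lambda>b. s * m k b + r * u b)) \<longlonglongrightarrow> D (\<lambda>b. s * z b + r * u b)"
      unfolding D_def by (intro tendsto_intros z)
    moreover have "\<delta> \<le> D (\<lambda>b. s * m k b + r * u b)" for k
      using that by (intro \<delta>_le add scale mC)
    ultimately have "\<delta> \<le> D (\<lambda>b. s * z b + r * u b)"
      by (intro tendsto_lowerbound[of _ _ sequentially]) auto
    with Dz_le show ?thesis by linarith
  qed
  \<comment> \<open>Moving from z in the direction u cannot decrease the distance, so q is
    non-negative on \<open>C\<close>.\<close>
  have "0 \<le> (\<Sum>b\<in>S. q b * c b)"
  proof (rule dual, rule nonneg_if_quadratic_perturbation)
    fix u r assume "u \<in> C" and r: "0 < (r::real)" "r \<le> 1"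
    have "D (\<lambda>b. 1 * z b + r * u b) - D z
        = 2 * r * (\<Sum>b\<in>S. q b * u b) + r\<^sup>2 * (\<Sum>b\<in>S. (u b)\<^sup>2)"
      unfolding D_def q_def sum_distrib_left sum.distrib[symmetric] sum_subtractf[symmetric]
      by (intro sum.cong refl) (simp add: power2_eq_square algebra_simps)
    with shift[OF \<open>u \<in> C\<close>, of 1 r] r
    show "0 \<le> 2 * r * (\<Sum>b\<in>S. q b * u b) + r\<^sup>2 * (\<Sum>b\<in>S. (u b)\<^sup>2)" by simp
  qed
  \<comment> \<open>Shrinking z towards the apex of the cone; r <= 1 keeps the factor 1 - r
    non-negative.\<close>
  moreover have "0 \<le> - (\<Sum>b\<in>S. q b * z b)"
  proof (rule nonneg_if_quadratic_perturbation)
    fix r assume r: "0 < (r::real)" "r \<le> 1"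
    have "D (\<lambda>b. (1 - r) * z b + 0 * 0) - D z
        = 2 * r * - (\<Sum>b\<in>S. q b * z b) + r\<^sup>2 * (\<Sum>b\<in>S. (z b)\<^sup>2)"
      unfolding D_def q_def sum_distrib_left sum.distrib[symmetric] sum_subtractf[symmetric]
        sum_negf[symmetric]
      by (intro sum.cong refl) (simp add: power2_eq_square algebra_simps)
    with shift[OF zero, of "1 - r" 0] r
    show "0 \<le> 2 * r * - (\<Sum>b\<in>S. q b * z b) + r\<^sup>2 * (\<Sum>b\<in>S. (z b)\<^sup>2)" by simp
  qed
  moreover have "(\<Sum>b\<in>S. q b * c b) = (\<Sum>b\<in>S. q b * z b) - (\<Sum>b\<in>S. (q b)\<^sup>2)"
    unfolding q_def sum_subtractf[symmetric]
    by (intro sum.cong refl) (simp add: power2_eq_square algebra_simps)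
  ultimately have "(\<Sum>b\<in>S. (q b)\<^sup>2) \<le> 0" by linarith
  then have "(\<Sum>b\<in>S. (q b)\<^sup>2) = 0" by (intro antisym sum_nonneg) auto
  then have q0: "z b = c b" if "b \<in> S" for b
    using S that by (subst (asm) sum_nonneg_eq_0_iff) (auto simp: q_def)
  have "\<forall>\<^sub>F k in sequentially. \<forall>b\<in>S. dist (m k b) (c b) < \<epsilon>"
    using S z q0 \<open>0 < \<epsilon>\<close> by (intro eventually_ball_finite ballI tendstoD) auto
  then obtain k where "\<forall>b\<in>S. dist (m k b) (c b) < \<epsilon>"
    by (auto simp: eventually_sequentially)
  then show ?thesis
    by (intro bexI[OF _ mC[of k]]) (auto simp: dist_real_def abs_minus_commute)
qed

section \<open>A space-filling curve\<close>

text \<open>The orbit x of a under the doubling map carries the rescaled remainder 2^k (a - partial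
  sum). It stays in [0, 1], also for a = 1, where all digits are 1.\<close>

lemma binary_expansion:
  fixes a :: real
  assumes "0 \<le> a" "a \<le> 1"
  obtains b :: "nat \<Rightarrow> bool" where "(\<lambda>k. of_bool (b k) / 2 ^ Suc k) sums a"
proof -
  define x where "x = rec_nat a (\<lambda>_ y. 2 * y - of_bool (1/2 \<le> y))"
  have x0: "x 0 = a" and xS: "x (Suc k) = 2 * x k - of_bool (1/2 \<le> x k)" for k
    by (auto simp: x_def)
  have rng: "0 \<le> x k \<and> x k \<le> 1" for k
    by (induction k) (use assms in \<open>auto simp: x0 xS\<close>)
  have part: "(\<Sum>k<n. of_bool (1/2 \<le> x k) / 2 ^ Suc k) = a - x n / 2 ^ n" for n
    by (induction n) (auto simp: x0 xS field_simps)
  have "(\<lambda>n. x n * (1/2) ^ n) \<longlonglongrightarrow> 0"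
  proof (rule tendsto_sandwich[of "\<lambda>_. 0" _ _ "\<lambda>n. (1/2) ^ n"])
    show "(\<lambda>n. (1/2 :: real) ^ n) \<longlonglongrightarrow> 0" by (intro LIMSEQ_realpow_zero) auto
    show "\<forall>\<^sub>F n in sequentially. x n * (1/2) ^ n \<le> (1/2) ^ n"
      using rng by (intro always_eventually allI mult_left_le_one_le) auto
    show "\<forall>\<^sub>F n in sequentially. 0 \<le> x n * (1/2) ^ n"
      using rng by (intro always_eventually allI mult_nonneg_nonneg) auto
  qed auto
  then have "(\<lambda>n. a - x n * (1/2) ^ n) \<longlonglongrightarrow> a - 0" by (intro tendsto_intros)
  then have "(\<lambda>k. of_bool (1/2 \<le> x k) / 2 ^ Suc k) sums a"
    unfolding sums_def part by (simp add: power_one_over)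
  then show thesis by (rule that)
qed

text \<open>Schoenberg's space-filling curve: the clamped cosine reads the first ternary digit
  (0 or 2) of a point of the Cantor set and is unaffected by the even integer part.\<close>

definition digit_wave :: "real \<Rightarrow> real" where
  "digit_wave t = max 0 (min 1 (1/2 - cos (pi * t)))"

lemma digit_wave_bounds: "0 \<le> digit_wave t" "digit_wave t \<le> 1"
  by (auto simp: digit_wave_def)

lemma continuous_on_digit_wave [continuous_intros]:
  fixes f :: "'a::t2_space \<Rightarrow> real"
  shows "continuous_on A f \<Longrightarrow> continuous_on A (\<lambda>x. digit_wave (f x))"
  unfolding digit_wave_def by (intro continuous_intros continuous_on_cos)

lemma digit_wave_add_even: "digit_wave (2 * real n + t) = digit_wave t"
proof -
  have "cos (pi * (2 * real n + t)) = cos (pi * t + 2 * real n * pi)"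
    by (simp add: algebra_simps)
  also have "\<dots> = cos (pi * t)" by (simp only: cos_add cos_2npi sin_2npi)
  finally show ?thesis by (simp add: digit_wave_def)
qed

lemma digit_wave_low: "0 \<le> t \<Longrightarrow> t \<le> 1/3 \<Longrightarrow> digit_wave t = 0"
proof -
  assume t: "0 \<le> t" "t \<le> 1/3"
  have "cos (pi * (1/3)) \<le> cos (pi * t)"
    using t by (intro cos_monotone_0_pi_le) (auto simp: field_simps)
  then show ?thesis by (simp add: digit_wave_def cos_60)
qed

lemma digit_wave_high: "2/3 \<le> t \<Longrightarrow> t \<le> 1 \<Longrightarrow> digit_wave t = 1"
proof -
  assume t: "2/3 \<le> t" "t \<le> 1"
  have "cos (pi * t) \<le> cos (pi * (2/3))"
    using t by (intro cos_monotone_0_pi_le) (auto simp: field_simps)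
  also have "\<dots> = - cos (pi / 3)"
  proof -
    have "pi * (2/3) = pi - pi / 3" by simp
    then show ?thesis by (simp only: cos_pi_minus)
  qed
  finally show ?thesis by (simp add: digit_wave_def cos_60)
qed

text \<open>The point is the Cantor number with ternary digits 2 * d j, and \<open>r j\<close> is
  its tail from position j on. Multiplying by 3^j splits off an integer that is even because every
  digit is 0 or 2, and \<open>r j\<close> lies in the lower or the upper third according to its
  leading digit.\<close>

lemma cantor_digits:
  fixes d :: "nat \<Rightarrow> bool"
  obtains t where "0 \<le> t" "t \<le> 1" "\<And>j. digit_wave (3 ^ j * t) = of_bool (d j)"
proof -
  define r where "r j = (\<Sum>l. 2 * of_bool (d (j + l)) / 3 ^ Suc l :: real)" for j
  have geo: "(\<lambda>l. 2 / 3 ^ Suc l :: real) sums 1"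
  proof -
    have "(\<lambda>l. 2/3 * (1/3) ^ l :: real) sums (2/3 * (1 / (1 - 1/3)))"
      by (intro sums_mult geometric_sums) auto
    then show ?thesis by (simp add: power_one_over)
  qed
  have summ: "summable (\<lambda>l. 2 * of_bool (d (j + l)) / 3 ^ Suc l :: real)" for j
    by (rule summable_comparison_test'[OF sums_summable[OF geo], of 0]) auto
  have r0: "0 \<le> r j" for j unfolding r_def by (intro suminf_nonneg summ) auto
  have r1: "r j \<le> 1" for j
    unfolding r_def by (subst sums_unique[OF geo], intro suminf_le summ sums_summable[OF geo]) auto
  have step: "r j = (2 * of_bool (d j) + r (Suc j)) / 3" for j
  proof -
    have "r j = 2 * of_bool (d j) / 3 + (\<Sum>l. 2 * of_bool (d (j + Suc l)) / 3 ^ Suc (Suc l) :: real)"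
      unfolding r_def using suminf_split_head[OF summ[of j]] by simp
    also have "(\<Sum>l. 2 * of_bool (d (j + Suc l)) / 3 ^ Suc (Suc l) :: real)
        = (\<Sum>l. (1/3) * (2 * of_bool (d (Suc j + l)) / 3 ^ Suc l))"
      by (intro suminf_cong) (simp add: field_simps)
    also have "\<dots> = (1/3) * r (Suc j)" unfolding r_def by (intro suminf_mult summ)
    finally show ?thesis by simp
  qed
  have "\<exists>n. 3 ^ j * r 0 = 2 * real n + r j" for j
  proof (induction j)
    case 0
    show ?case by (intro exI[of _ 0]) simp
  next
    case (Suc j)
    then obtain n where n: "3 ^ j * r 0 = 2 * real n + r j" by blast
    have "3 ^ Suc j * r 0 = 3 * (2 * real n + r j)" by (simp add: n[symmetric])
    also have "\<dots> = 2 * real (3 * n + of_bool (d j)) + r (Suc j)" by (subst step) simp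
    finally show ?case by blast
  qed
  then have "digit_wave (3 ^ j * r 0) = digit_wave (r j)" for j
    using digit_wave_add_even by metis
  moreover have "digit_wave (r j) = of_bool (d j)" for j
  proof (cases "d j")
    case True
    then show ?thesis using step[of j] r0[of "Suc j"] r1[of "Suc j"]
      by (auto intro!: digit_wave_high)
  next
    case False
    then show ?thesis using step[of j] r0[of "Suc j"] r1[of "Suc j"]
      by (auto intro!: digit_wave_low)
  qed
  ultimately show thesis by (intro that[of "r 0"] r0 r1) simp
qed

text \<open>The k-th binary digit of coordinate i is read from the ternary position
  \<open>prod_encode (i, k)\<close>, so one Cantor number stores all coordinates at once. The
  geometric weights make each series converge uniformly, hence continuously.\<close>

lemma continuous_surjection_Hilbert_cube:
  obtains f :: "nat \<Rightarrow> real \<Rightarrow> real"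
  where "\<And>i. continuous_on UNIV (f i)" "\<And>i t. 0 \<le> f i t" "\<And>i t. f i t \<le> 1"
    "\<And>a. (\<And>i. 0 \<le> a i \<and> a i \<le> 1) \<Longrightarrow> \<exists>t\<in>{0..1}. \<forall>i. f i t = a i"
proof -
  define g where "g i k t = digit_wave (3 ^ prod_encode (i, k) * t) / 2 ^ Suc k" for i k t
  define f where "f i t = (\<Sum>k. g i k t)" for i t
  have geo: "(\<lambda>k. 1 / 2 ^ Suc k :: real) sums 1"
    using power_half_series by (simp add: power_one_over)
  have g: "0 \<le> g i k t" "g i k t \<le> 1 / 2 ^ Suc k" for i k t
    unfolding g_def using digit_wave_bounds by (auto intro: divide_right_mono)
  have summ: "summable (\<lambda>k. g i k t)" for i t
    by (rule summable_comparison_test'[OF sums_summable[OF geo], of 0]) (use g in auto)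
  have "continuous_on UNIV (f i)" for i
  proof (rule uniform_limit_theorem[where F = sequentially])
    show "uniform_limit UNIV (\<lambda>n t. \<Sum>k<n. g i k t) (f i) sequentially"
      unfolding f_def
      by (rule Weierstrass_m_test[OF _ sums_summable[OF geo]]) (use g in auto)
    show "\<forall>\<^sub>F n in sequentially. continuous_on UNIV (\<lambda>t. \<Sum>k<n. g i k t)"
      unfolding g_def by (intro always_eventually allI continuous_intros) auto
  qed auto
  moreover have "0 \<le> f i t" for i t
    unfolding f_def by (intro suminf_nonneg summ g)
  moreover have "f i t \<le> 1" for i t
    unfolding f_def by (subst sums_unique[OF geo], intro suminf_le g summ sums_summable[OF geo])
  moreover have "\<exists>t\<in>{0..1}. \<forall>i. f i t = a i" if "\<And>i. 0 \<le> a i \<and> a i \<le> 1" for a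
  proof -
    have "\<exists>b :: nat \<Rightarrow> bool. (\<lambda>k. of_bool (b k) / 2 ^ Suc k) sums a i" for i
      using binary_expansion[of "a i"] that by metis
    then obtain b :: "nat \<Rightarrow> nat \<Rightarrow> bool"
      where b: "(\<lambda>k. of_bool (b i k) / 2 ^ Suc k) sums a i" for i by metis
    obtain t where "0 \<le> t" "t \<le> 1"
      and t: "digit_wave (3 ^ j * t) = of_bool (case_prod b (prod_decode j))" for j
      by (rule cantor_digits[of "\<lambda>j. case_prod b (prod_decode j)"]) blast
    have "f i t = a i" for i
      unfolding f_def g_def t using sums_unique[OF b[of i]] by simp
    with \<open>0 \<le> t\<close> \<open>t \<le> 1\<close> show ?thesis by (intro bexI[of _ t]) auto
  qed
  ultimately show thesis by (rule that)
qed

text \<open>Coordinate 0 of the cube serves the radial variable, the others, rescaled to [-1, 1],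
  the directions. The full box is used since it contains every unit vector and also the value sgn 0
  = 0. Preimages inside {0..1} will give tightness.\<close>

lemma continuous_surjection_box:
  obtains \<theta> :: "real \<Rightarrow> real" and \<omega> :: "real \<Rightarrow> real^'n::finite"
  where "continuous_on UNIV \<theta>" "\<And>s. 0 \<le> \<theta> s" "\<And>s. \<theta> s \<le> 1"
    "continuous_on UNIV \<omega>" "\<And>s i. \<bar>\<omega> s $ i\<bar> \<le> 1"
    "\<And>y z. 0 \<le> y \<Longrightarrow> y \<le> 1 \<Longrightarrow> (\<And>i. \<bar>z $ i\<bar> \<le> 1) \<Longrightarrow> \<exists>s\<in>{0..1}. \<theta> s = y \<and> \<omega> s = z"
proof -
  obtain f :: "nat \<Rightarrow> real \<Rightarrow> real" where f: "\<And>i. continuous_on UNIV (f i)"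
    "\<And>i t. 0 \<le> f i t" "\<And>i t. f i t \<le> 1"
    and surj: "\<And>a. (\<And>i. 0 \<le> a i \<and> a i \<le> 1) \<Longrightarrow> \<exists>t\<in>{0..1}. \<forall>i. f i t = a i"
    by (rule continuous_surjection_Hilbert_cube) blast
  obtain e :: "'n \<Rightarrow> nat" where e: "inj e"
    using finite_imp_inj_to_nat_seg[of "UNIV :: 'n set"] by auto
  define \<omega> :: "real \<Rightarrow> real^'n" where "\<omega> s = (\<chi> i. 2 * f (Suc (e i)) s - 1)" for s
  show thesis
  proof (rule that[of "f 0" \<omega>])
    show "continuous_on UNIV \<omega>"
      unfolding \<omega>_def by (intro continuous_intros f)
    show "\<bar>\<omega> s $ i\<bar> \<le> 1" for s i
      using f(2)[of "Suc (e i)" s] f(3)[of "Suc (e i)" s] by (simp add: \<omega>_def abs_le_iff)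
    fix y :: real and z :: "real^'n" assume y: "0 \<le> y" "y \<le> 1" and z: "\<And>i. \<bar>z $ i\<bar> \<le> 1"
    \<comment> \<open>\<open>inv e j\<close> is some index even when j is outside the range of
      \<open>e\<close>, so every a j lies in [0, 1].\<close>
    define a where "a j = (case j of 0 \<Rightarrow> y | Suc j \<Rightarrow> (z $ inv e j + 1) / 2)" for j
    have "0 \<le> a j \<and> a j \<le> 1" for j
      using y z[of "inv e (j - 1)"] by (cases j) (auto simp: a_def abs_le_iff)
    from surj[of a, OF this] obtain s where "s \<in> {0..1}" and s: "\<And>j. f j s = a j" by blast
    have "f 0 s = y" by (simp add: s a_def)
    moreover have "\<omega> s = z" by (simp add: vec_eq_iff \<omega>_def s a_def inv_f_f[OF e] field_simps)
    ultimately show "\<exists>s\<in>{0..1}. f 0 s = y \<and> \<omega> s = z" using \<open>s \<in> {0..1}\<close> by blast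
  qed (use f in auto)
qed

section \<open>Weak limits of integrals with a pole\<close>

text \<open>Bernoulli's inequality for z = y / (y + \<epsilon>): 1 - z^k <= k (1 - z) <= k
  \<epsilon> / y. The price of moving the pole is one more power of 1 / y.\<close>

lemma inverse_power_shift_bound:
  fixes y \<epsilon> g :: real
  assumes "0 < y" "0 < \<epsilon>" "\<bar>g\<bar> \<le> 1"
  shows "\<bar>g / y ^ k - g / (y + \<epsilon>) ^ k\<bar> \<le> real k * \<epsilon> * (1 / y ^ Suc k)"
proof -
  define z where "z = y / (y + \<epsilon>)"
  have z: "0 < z" "z \<le> 1" and z1: "1 - z \<le> \<epsilon> / y"
    using assms by (auto simp: z_def field_simps)
  have "1 + real k * (z - 1) \<le> (1 + (z - 1)) ^ k"
    using z by (intro Bernoulli_inequality) auto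
  then have "1 - z ^ k \<le> real k * (1 - z)" by (simp add: algebra_simps)
  also have "\<dots> \<le> real k * (\<epsilon> / y)" using z1 by (intro mult_left_mono) auto
  finally have le: "1 - z ^ k \<le> real k * (\<epsilon> / y)" .
  have eq: "g / y ^ k - g / (y + \<epsilon>) ^ k = g * ((1 - z ^ k) / y ^ k)"
    using assms by (simp add: z_def power_divide field_simps)
  have "0 \<le> (1 - z ^ k) / y ^ k" using z assms by (simp add: power_le_one)
  then have "\<bar>g / y ^ k - g / (y + \<epsilon>) ^ k\<bar> \<le> 1 * ((1 - z ^ k) / y ^ k)"
    unfolding eq abs_mult using assms by (intro mult_mono) auto
  also have "\<dots> \<le> real k * (\<epsilon> / y) / y ^ k"
    using divide_right_mono[OF le, of "y ^ k"] assms by simp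
  finally show ?thesis by simp
qed

text \<open>The error is paid for by the next higher pole and depends on the measure only through
  \<open>B\<close>, so it is uniform over a family of measures with a common bound.\<close>

lemma integral_inverse_power_shift_bound:
  fixes \<theta> G :: "'a \<Rightarrow> real"
  assumes "finite_measure M"
    and [measurable]: "\<theta> \<in> borel_measurable M" "G \<in> borel_measurable M"
    and pos: "AE s in M. 0 < \<theta> s"
    and int: "\<And>k. integrable M (\<lambda>s. 1 / \<theta> s ^ k)"
    and B: "(\<integral>s. 1 / \<theta> s ^ Suc k \<partial>M) \<le> B"
    and G: "\<And>s. \<bar>G s\<bar> \<le> 1" and \<epsilon>: "0 < \<epsilon>"
  shows "\<bar>(\<integral>s. G s / \<theta> s ^ k \<partial>M) - (\<integral>s. G s / (\<theta> s + \<epsilon>) ^ k \<partial>M)\<bar> \<le> real k * \<epsilon> * B"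
    and "integrable M (\<lambda>s. G s / \<theta> s ^ k)"
proof -
  interpret finite_measure M by fact
  have i1: "integrable M (\<lambda>s. G s / \<theta> s ^ k)"
    by (rule Bochner_Integration.integrable_bound[OF int[of k]])
      (use pos G in \<open>auto elim!: eventually_mono simp: divide_right_mono\<close>)
  then show "integrable M (\<lambda>s. G s / \<theta> s ^ k)" .
  have i2: "integrable M (\<lambda>s. G s / (\<theta> s + \<epsilon>) ^ k)"
  proof (rule Bochner_Integration.integrable_bound[OF int[of k]])
    show "AE s in M. norm (G s / (\<theta> s + \<epsilon>) ^ k) \<le> norm (1 / \<theta> s ^ k)"
      using pos
    proof (rule eventually_mono)
      fix s assume "0 < \<theta> s"
      then show "norm (G s / (\<theta> s + \<epsilon>) ^ k) \<le> norm (1 / \<theta> s ^ k)"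
        using \<epsilon> G[of s] by (simp add: frac_le power_mono)
    qed
  qed auto
  have "\<bar>(\<integral>s. G s / \<theta> s ^ k \<partial>M) - (\<integral>s. G s / (\<theta> s + \<epsilon>) ^ k \<partial>M)\<bar>
      = \<bar>\<integral>s. G s / \<theta> s ^ k - G s / (\<theta> s + \<epsilon>) ^ k \<partial>M\<bar>"
    using i1 i2 by simp
  also have "\<dots> \<le> (\<integral>s. \<bar>G s / \<theta> s ^ k - G s / (\<theta> s + \<epsilon>) ^ k\<bar> \<partial>M)"
    by (rule integral_abs_bound)
  also have "\<dots> \<le> (\<integral>s. real k * \<epsilon> * (1 / \<theta> s ^ Suc k) \<partial>M)"
  proof (rule integral_mono_AE)
    show "AE s in M. \<bar>G s / \<theta> s ^ k - G s / (\<theta> s + \<epsilon>) ^ k\<bar> \<le> real k * \<epsilon> * (1 / \<theta> s ^ Suc k)"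
      using pos by (rule eventually_mono) (rule inverse_power_shift_bound[OF _ \<epsilon> G])
  qed (use i1 i2 in \<open>auto intro!: integrable_mult_right int simp del: power_Suc times_divide_eq_right\<close>)
  also have "\<dots> = real k * \<epsilon> * (\<integral>s. 1 / \<theta> s ^ Suc k \<partial>M)"
    by (rule integral_mult_right_zero)
  also have "\<dots> \<le> real k * \<epsilon> * B" using B \<epsilon> by (intro mult_left_mono) auto
  finally show "\<bar>(\<integral>s. G s / \<theta> s ^ k \<partial>M) - (\<integral>s. G s / (\<theta> s + \<epsilon>) ^ k \<partial>M)\<bar> \<le> real k * \<epsilon> * B" .
qed

text \<open>Replacing \<open>\<theta>\<close> by \<open>\<theta>\<close> + \<epsilon> makes the
  integrand bounded and continuous, where weak convergence applies. The bound for exponent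
  \<open>Suc k\<close> makes the error of this replacement small uniformly in n and for the limit,
  so both limits can be interchanged.\<close>

lemma weak_limit_singular_integral:
  fixes \<mu> :: "nat \<Rightarrow> real measure" and \<theta> :: "real \<Rightarrow> real"
  assumes \<mu>: "\<And>n. real_distribution (\<mu> n)" and M: "real_distribution M" and conv: "weak_conv_m \<mu> M"
    and \<theta>: "continuous_on UNIV \<theta>" "\<And>s. 0 \<le> \<theta> s" "\<And>s. \<theta> s \<le> 1"
    and pos: "\<And>n. AE s in \<mu> n. 0 < \<theta> s"
    and int: "\<And>n k. integrable (\<mu> n) (\<lambda>s. 1 / \<theta> s ^ k)"
    and bound: "\<And>k. \<exists>B. \<forall>\<^sub>F n in sequentially. (\<integral>s. 1 / \<theta> s ^ k \<partial>\<mu> n) \<le> B"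
  shows "AE s in M. 0 < \<theta> s"
    and "integrable M (\<lambda>s. 1 / \<theta> s ^ k)"
    and "\<lbrakk>continuous_on UNIV G; \<And>s. \<bar>G s\<bar> \<le> 1\<rbrakk> \<Longrightarrow>
      (\<lambda>n. \<integral>s. G s / \<theta> s ^ k \<partial>\<mu> n) \<longlonglongrightarrow> (\<integral>s. G s / \<theta> s ^ k \<partial>M)"
proof -
  interpret \<mu>: real_distribution "\<mu> n" for n by fact
  interpret M: real_distribution M by fact
  have \<theta>m [measurable]: "\<theta> \<in> borel_measurable borel"
    using \<theta>(1) by (rule borel_measurable_continuous_onI)
  obtain B where B: "\<forall>\<^sub>F n in sequentially. (\<integral>s. 1 / \<theta> s ^ k \<partial>\<mu> n) \<le> B k" for k
    using bound by metis
  have shift_conv: "(\<lambda>n. \<integral>s. G s / (\<theta> s + \<epsilon>) ^ k \<partial>\<mu> n) \<longlonglongrightarrow> (\<integral>s. G s / (\<theta> s + \<epsilon>) ^ k \<partial>M)"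
    if G: "continuous_on UNIV G" "\<And>s. \<bar>G s\<bar> \<le> 1" and \<epsilon>: "0 < \<epsilon>" for G \<epsilon> k
  proof (rule weak_conv_imp_integral_bdd_continuous_conv[OF \<mu> M conv])
    have ne: "\<theta> s + \<epsilon> \<noteq> 0" for s using \<theta>(2)[of s] \<epsilon> by linarith
    have "continuous_on UNIV (\<lambda>s. G s / (\<theta> s + \<epsilon>) ^ k)"
      by (intro continuous_intros G \<theta>) (auto simp: ne)
    then show "isCont (\<lambda>s. G s / (\<theta> s + \<epsilon>) ^ k) x" for x
      by (simp add: continuous_on_eq_continuous_at)
    show "norm (G s / (\<theta> s + \<epsilon>) ^ k) \<le> 1 / \<epsilon> ^ k" for s
      using G(2)[of s] \<epsilon> \<theta>(2)[of s] by (simp add: frac_le power_mono)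
  qed
  have shift_int: "integrable M (\<lambda>s. 1 / (\<theta> s + \<epsilon>) ^ k)" if "0 < \<epsilon>" for \<epsilon> k
    by (rule M.integrable_const_bound[of _ "1 / \<epsilon> ^ k"])
      (use that \<theta>(2) in \<open>auto intro!: frac_le power_mono\<close>)
  \<comment> \<open>The shifted integrands lie below the singular ones, so the uniform bounds pass
    to \<open>M\<close>.\<close>
  have shift_B: "(\<integral>s. 1 / (\<theta> s + \<epsilon>) ^ k \<partial>M) \<le> B k" if \<epsilon>: "0 < \<epsilon>" for \<epsilon> k
  proof (rule tendsto_upperbound)
    show "(\<lambda>n. \<integral>s. 1 / (\<theta> s + \<epsilon>) ^ k \<partial>\<mu> n) \<longlonglongrightarrow> (\<integral>s. 1 / (\<theta> s + \<epsilon>) ^ k \<partial>M)"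
      using shift_conv[of "\<lambda>_. 1" \<epsilon> k] \<epsilon> by simp
    have le: "(\<integral>s. 1 / (\<theta> s + \<epsilon>) ^ k \<partial>\<mu> n) \<le> (\<integral>s. 1 / \<theta> s ^ k \<partial>\<mu> n)" for n
    proof (rule integral_mono_AE)
      show "integrable (\<mu> n) (\<lambda>s. 1 / (\<theta> s + \<epsilon>) ^ k)"
        by (rule \<mu>.integrable_const_bound[of _ "1 / \<epsilon> ^ k"])
          (use that \<theta>(2) in \<open>auto intro!: frac_le power_mono\<close>)
      show "AE s in \<mu> n. 1 / (\<theta> s + \<epsilon>) ^ k \<le> 1 / \<theta> s ^ k"
        using pos[of n] by (rule eventually_mono) (use \<epsilon> in \<open>auto intro!: frac_le power_mono\<close>)
    qed (rule int)
    show "\<forall>\<^sub>F n in sequentially. (\<integral>s. 1 / (\<theta> s + \<epsilon>) ^ k \<partial>\<mu> n) \<le> B k"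
      using B[of k] by (rule eventually_mono) (use le order_trans in blast)
  qed auto
  show AE: "AE s in M. 0 < \<theta> s"
  proof -
    let ?Z = "{s. \<theta> s = 0}"
    have Zm [measurable]: "?Z \<in> sets M" by simp
    \<comment> \<open>Chebyshev's argument with the simple pole: the shifted integrand equals 1 /
      \<epsilon> on the zero set of \<open>\<theta>\<close>.\<close>
    have Z: "measure M ?Z \<le> \<epsilon> * B 1" if "0 < \<epsilon>" for \<epsilon>
    proof -
      have "measure M ?Z / \<epsilon> = (\<integral>s. indicator ?Z s / \<epsilon> \<partial>M)" by simp
      also have "\<dots> \<le> (\<integral>s. 1 / (\<theta> s + \<epsilon>) ^ 1 \<partial>M)"
      proof (rule integral_mono[OF _ shift_int[OF that]])
        show "integrable M (\<lambda>s. indicator ?Z s / \<epsilon>)"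
          by (intro integrable_divide integrable_real_indicator) (auto simp: M.emeasure_finite less_top[symmetric])
      qed (use that \<theta>(2) in \<open>auto simp: indicator_def\<close>)
      also have "\<dots> \<le> B 1" by (rule shift_B[OF that])
      finally show ?thesis using that by (simp add: field_simps)
    qed
    have "((\<lambda>\<epsilon>. \<epsilon> * B 1) \<longlongrightarrow> 0 * B 1) (at_right 0)" by (intro tendsto_intros)
    then have "measure M ?Z \<le> 0 * B 1"
      by (rule tendsto_lowerbound) (use Z in \<open>auto simp: eventually_at_right_less eventually_at_right_field intro: exI[of _ 1]\<close>)
    then have "measure M ?Z = 0" using measure_nonneg[of M ?Z] by simp
    then have "?Z \<in> null_sets M" by (simp add: null_sets_def M.emeasure_eq_measure)
    then show ?thesis by (rule AE_I') (use \<theta>(2) in \<open>auto simp: less_le\<close>)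
  qed
  have lim: "integrable M (\<lambda>s. 1 / \<theta> s ^ k) \<and> (\<integral>s. 1 / \<theta> s ^ k \<partial>M) \<le> B k" for k
  proof -
    \<comment> \<open>The shifts decrease to 0, so f i increases to the singular integrand and
      monotone convergence applies.\<close>
    define f where "f i s = 1 / (\<theta> s + inverse (real (Suc i))) ^ k" for i s
    have mono: "mono (\<lambda>i. f i s)" for s
      unfolding f_def by (intro monoI frac_le power_mono add_left_mono zero_less_power add_nonneg_pos)
        (use \<theta>(2) in \<open>auto simp: field_simps intro!: add_nonneg_nonneg\<close>)
    have fi: "integrable M (f i)" and fB: "integral\<^sup>L M (f i) \<le> B k" for i
      unfolding f_def by (auto intro!: shift_int shift_B)
    have "incseq (\<lambda>i. integral\<^sup>L M (f i))"
      using mono by (intro monoI integral_mono fi) (auto simp: mono_def)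
    then obtain x where x: "(\<lambda>i. integral\<^sup>L M (f i)) \<longlonglongrightarrow> x"
      using incseq_convergent[of "\<lambda>i. integral\<^sup>L M (f i)" "B k"] fB by blast
    have fl: "AE s in M. (\<lambda>i. f i s) \<longlonglongrightarrow> 1 / \<theta> s ^ k"
      using AE
    proof (rule eventually_mono)
      fix s assume "0 < \<theta> s"
      have "(\<lambda>i. f i s) \<longlonglongrightarrow> 1 / (\<theta> s + 0) ^ k"
        unfolding f_def by (intro tendsto_intros LIMSEQ_inverse_real_of_nat) (use \<open>0 < \<theta> s\<close> in auto)
      then show "(\<lambda>i. f i s) \<longlonglongrightarrow> 1 / \<theta> s ^ k" by simp
    qed
    have mono_AE: "AE s in M. mono (\<lambda>i. f i s)" and nn: "AE s in M. 0 \<le> f i s" for i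
      using mono \<theta>(2) by (auto simp: f_def)
    have "integrable M (\<lambda>s. 1 / \<theta> s ^ k)" "(\<integral>s. 1 / \<theta> s ^ k \<partial>M) = x"
      by (rule integral_monotone_convergence_nonneg[OF fi mono_AE nn fl x]; simp)+
    moreover have "x \<le> B k" by (rule LIMSEQ_le_const2[OF x]) (use fB in auto)
    ultimately show ?thesis by simp
  qed
  then show "integrable M (\<lambda>s. 1 / \<theta> s ^ k)" by blast
  assume G: "continuous_on UNIV G" "\<And>s. \<bar>G s\<bar> \<le> 1"
  have Gm [measurable]: "G \<in> borel_measurable borel"
    using G(1) by (rule borel_measurable_continuous_onI)
  define b where "b = \<bar>B (Suc k)\<bar> + 1"
  show "(\<lambda>n. \<integral>s. G s / \<theta> s ^ k \<partial>\<mu> n) \<longlonglongrightarrow> (\<integral>s. G s / \<theta> s ^ k \<partial>M)"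
  proof (rule tendstoI)
    fix e :: real assume "0 < e"
    \<comment> \<open>One third of e for each of the two shift errors and one for the weak
      convergence. The factor k + 1 avoids a zero denominator for k = 0 and makes the estimate
      strict.\<close>
    define \<epsilon> where "\<epsilon> = (e / 3) / ((real k + 1) * b)"
    have "0 < b" by (simp add: b_def add_nonneg_pos)
    then have "0 < \<epsilon>" using \<open>0 < e\<close> by (simp add: \<epsilon>_def)
    have "(real k + 1) * \<epsilon> * b = e / 3"
    proof -
      have nz: "(real k + 1) * b \<noteq> 0" using \<open>0 < b\<close> by simp
      have "\<epsilon> * ((real k + 1) * b) = e / 3" by (rule nonzero_eq_divide_eq[THEN iffD1, OF nz \<epsilon>_def])
      then show ?thesis by (simp only: mult_ac)
    qed
    moreover have "0 < \<epsilon> * b" using \<open>0 < \<epsilon>\<close> \<open>0 < b\<close> by simp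
    ultimately have small: "real k * \<epsilon> * b < e / 3" by (simp add: algebra_simps)
    have near: "\<forall>\<^sub>F n in sequentially. dist (\<integral>s. G s / (\<theta> s + \<epsilon>) ^ k \<partial>\<mu> n) (\<integral>s. G s / (\<theta> s + \<epsilon>) ^ k \<partial>M) < e / 3"
      using shift_conv[OF G \<open>0 < \<epsilon>\<close>] \<open>0 < e\<close> by (intro tendstoD) auto
    have limb: "(\<integral>s. 1 / \<theta> s ^ Suc k \<partial>M) \<le> b"
      unfolding b_def using conjunct2[OF lim[of "Suc k"]] abs_ge_self[of "B (Suc k)"] by linarith
    show "\<forall>\<^sub>F n in sequentially. dist (\<integral>s. G s / \<theta> s ^ k \<partial>\<mu> n) (\<integral>s. G s / \<theta> s ^ k \<partial>M) < e"
      using near B[of "Suc k"]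
    proof eventually_elim
      case (elim n)
      have "\<bar>(\<integral>s. G s / \<theta> s ^ k \<partial>\<mu> n) - (\<integral>s. G s / (\<theta> s + \<epsilon>) ^ k \<partial>\<mu> n)\<bar> \<le> real k * \<epsilon> * b"
        by (rule integral_inverse_power_shift_bound)
          (use pos int elim(2) G(2) \<open>0 < \<epsilon>\<close> in \<open>auto simp: b_def simp del: power_Suc intro: \<mu>.finite_measure_axioms\<close>)
      moreover have "\<bar>(\<integral>s. G s / \<theta> s ^ k \<partial>M) - (\<integral>s. G s / (\<theta> s + \<epsilon>) ^ k \<partial>M)\<bar> \<le> real k * \<epsilon> * b"
        by (rule integral_inverse_power_shift_bound)
          (use AE lim limb G(2) \<open>0 < \<epsilon>\<close> in \<open>auto simp del: power_Suc intro: M.finite_measure_axioms\<close>)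
      ultimately show ?case using elim(1) small unfolding dist_real_def by linarith
    qed
  qed
qed

section \<open>Multi-indices and binomial sums\<close>

text \<open>Distributivity over the box of multi-indices below \<alpha>; it reduces the multivariate
  binomial identities to one variable.\<close>

lemma sum_prod_mindex_le:
  fixes g :: "'n::finite \<Rightarrow> nat \<Rightarrow> real"
  shows "(\<Sum>\<beta>\<in>{\<beta>. mindex_le \<beta> \<alpha>}. \<Prod>i\<in>UNIV. g i (\<beta> i)) = (\<Prod>i\<in>UNIV. \<Sum>j\<le>\<alpha> i. g i j)"
proof -
  have "{\<beta>. mindex_le \<beta> \<alpha>} = PiE UNIV (\<lambda>i. {..\<alpha> i})"
    by (auto simp: mindex_le_def PiE_def Pi_def)
  then show ?thesis by (simp add: prod_sum_PiE)
qed

lemma finite_mindex_le: "finite {\<beta> :: ('n::finite) mindex. mindex_le \<beta> \<alpha>}"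
proof -
  have "{\<beta>. mindex_le \<beta> \<alpha>} = PiE UNIV (\<lambda>i. {..\<alpha> i})"
    by (auto simp: mindex_le_def PiE_def Pi_def)
  then show ?thesis by (simp add: finite_PiE)
qed

lemma finite_mabs_le: "finite {\<beta> :: ('n::finite) mindex. mabs \<beta> \<le> d}"
proof (rule finite_subset)
  show "{\<beta> :: 'n mindex. mabs \<beta> \<le> d} \<subseteq> {\<beta>. mindex_le \<beta> (\<lambda>_. d)}"
  proof safe
    fix \<beta> :: "'n mindex" assume "mabs \<beta> \<le> d"
    moreover have "\<beta> i \<le> mabs \<beta>" for i
      unfolding mabs_def by (intro member_le_sum) auto
    ultimately show "mindex_le \<beta> (\<lambda>_. d)" unfolding mindex_le_def using order_trans by blast
  qed
qed (rule finite_mindex_le)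

text \<open>The binomial theorem in each coordinate. Read through \<open>diag_eig\<close>: the
  moments of the point mass at x have eigenvalues \<open>xpow (x + 1) \<alpha>\<close>, so their
  operator is a substitution.\<close>

lemma sum_mbinom_xpow:
  "(\<Sum>\<beta>\<in>{\<beta>. mindex_le \<beta> \<alpha>}. real (mbinom \<alpha> \<beta>) * xpow x \<beta>) = xpow (x + 1) \<alpha>"
proof -
  have "real (mbinom \<alpha> \<beta>) * xpow x \<beta> = (\<Prod>i\<in>UNIV. real (\<alpha> i choose \<beta> i) * (x $ i) ^ \<beta> i)" for \<beta>
    by (simp add: mbinom_def xpow_def prod.distrib)
  then show ?thesis
    using sum_prod_mindex_le[of "\<lambda>i j. real (\<alpha> i choose j) * (x $ i) ^ j" \<alpha>]
    by (simp add: xpow_def binomial_ring)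
qed

text \<open>The sign of the inverse binomial transform. Because of truncated subtraction it is
  meaningful only for \<beta> below \<alpha>; elsewhere the accompanying \<open>mbinom\<close>
  vanishes.\<close>

definition msign :: "('n::finite) mindex \<Rightarrow> 'n mindex \<Rightarrow> real" where
  "msign \<alpha> \<beta> = (\<Prod>i\<in>UNIV. (- 1) ^ (\<alpha> i - \<beta> i))"

lemma sum_signed_mbinom_xpow:
  "(\<Sum>\<beta>\<in>{\<beta>. mindex_le \<beta> \<alpha>}. msign \<alpha> \<beta> * real (mbinom \<alpha> \<beta>) * xpow x \<beta>) = xpow (x - 1) \<alpha>"
proof -
  have "msign \<alpha> \<beta> * real (mbinom \<alpha> \<beta>) * xpow x \<beta>
      = (\<Prod>i\<in>UNIV. real (\<alpha> i choose \<beta> i) * (x $ i) ^ \<beta> i * (- 1) ^ (\<alpha> i - \<beta> i))" for \<beta>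
    by (simp add: mbinom_def xpow_def msign_def prod.distrib)
  moreover have "(\<Sum>j\<le>n. real (n choose j) * y ^ j * (- 1) ^ (n - j)) = (y - 1) ^ n" for n y
    using binomial_ring[of y "-1" n] by simp
  ultimately show ?thesis
    using sum_prod_mindex_le[of "\<lambda>i j. real (\<alpha> i choose j) * (x $ i) ^ j * (- 1) ^ (\<alpha> i - j)" \<alpha>]
    by (simp add: xpow_def)
qed

text \<open>Since C(b,j) C(j,g) = C(b,g) C(b-g,j-g), the sum collapses to C(b,g) (1 -
  1)^(b-g).\<close>

lemma signed_binomial_orthogonality:
  "(\<Sum>j\<le>b. (- 1) ^ (b - j) * real (b choose j) * real (j choose g)) = of_bool (b = g)"
proof (cases "g \<le> b")
  case True
  have "(\<Sum>j\<le>b. (- 1) ^ (b - j) * real (b choose j) * real (j choose g))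
      = (\<Sum>j\<in>{g..b}. (- 1) ^ (b - j) * real (b choose j) * real (j choose g))"
    by (intro sum.mono_neutral_right) auto
  also have "\<dots> = (\<Sum>j\<in>{g..b}. real (b choose g) * (real (b - g choose (j - g)) * (- 1) ^ (b - j)))"
  proof (intro sum.cong refl)
    fix j assume "j \<in> {g..b}"
    then have "real (b choose j) * real (j choose g) = real (b choose g) * real (b - g choose (j - g))"
      unfolding of_nat_mult[symmetric] by (subst choose_mult) auto
    then show "(- 1) ^ (b - j) * real (b choose j) * real (j choose g)
        = real (b choose g) * (real (b - g choose (j - g)) * (- 1) ^ (b - j))" by simp
  qed
  also have "\<dots> = real (b choose g) * (\<Sum>i\<le>b - g. real (b - g choose i) * 1 ^ i * (- 1) ^ (b - g - i))"
    unfolding sum_distrib_left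
    by (rule sum.reindex_bij_witness[of _ "\<lambda>i. i + g" "\<lambda>j. j - g"]) (use True in auto)
  also have "\<dots> = real (b choose g) * 0 ^ (b - g)"
    using binomial_ring[of "1::real" "-1" "b - g"] by simp
  finally show ?thesis using True by (auto simp: power_0_left)
next
  case False
  then show ?thesis by (auto intro!: sum.neutral)
qed

text \<open>Binomial inversion: it recovers the coefficients c from the eigenvalues, coordinate by
  coordinate.\<close>

lemma diag_eig_inversion:
  "(\<Sum>\<alpha>\<in>{\<alpha>. mindex_le \<alpha> \<beta>}. msign \<beta> \<alpha> * real (mbinom \<beta> \<alpha>) * diag_eig c \<alpha>) = c \<beta>"
proof -
  \<comment> \<open>Extending the inner range to all \<gamma> below \<beta> makes it independent of
    \<alpha>, so the sums can be swapped; the added terms have a vanishing binomial.\<close>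
  have eig: "diag_eig c \<alpha> = (\<Sum>\<gamma>\<in>{\<gamma>. mindex_le \<gamma> \<beta>}. real (mbinom \<alpha> \<gamma>) * c \<gamma>)"
    if "mindex_le \<alpha> \<beta>" for \<alpha>
    unfolding diag_eig_def
  proof (intro sum.mono_neutral_left finite_mindex_le ballI)
    show "{\<gamma>. mindex_le \<gamma> \<alpha>} \<subseteq> {\<gamma>. mindex_le \<gamma> \<beta>}"
      using that by (auto simp: mindex_le_def intro: order_trans)
    fix \<gamma> assume "\<gamma> \<in> {\<gamma>. mindex_le \<gamma> \<beta>} - {\<gamma>. mindex_le \<gamma> \<alpha>}"
    then have "mbinom \<alpha> \<gamma> = 0" by (auto simp: mindex_le_def mbinom_def not_le)
    then show "real (mbinom \<alpha> \<gamma>) * c \<gamma> = 0" by simp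
  qed
  have "(\<Sum>\<alpha>\<in>{\<alpha>. mindex_le \<alpha> \<beta>}. msign \<beta> \<alpha> * real (mbinom \<beta> \<alpha>) * diag_eig c \<alpha>)
      = (\<Sum>\<alpha>\<in>{\<alpha>. mindex_le \<alpha> \<beta>}. \<Sum>\<gamma>\<in>{\<gamma>. mindex_le \<gamma> \<beta>}.
          msign \<beta> \<alpha> * real (mbinom \<beta> \<alpha>) * real (mbinom \<alpha> \<gamma>) * c \<gamma>)"
    by (intro sum.cong refl) (simp add: eig sum_distrib_left mult.assoc)
  also have "\<dots> = (\<Sum>\<gamma>\<in>{\<gamma>. mindex_le \<gamma> \<beta>}. (\<Sum>\<alpha>\<in>{\<alpha>. mindex_le \<alpha> \<beta>}.
          msign \<beta> \<alpha> * real (mbinom \<beta> \<alpha>) * real (mbinom \<alpha> \<gamma>)) * c \<gamma>)"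
    by (subst sum.swap) (simp add: sum_distrib_right)
  also have "\<dots> = (\<Sum>\<gamma>\<in>{\<gamma>. mindex_le \<gamma> \<beta>}. of_bool (\<gamma> = \<beta>) * c \<gamma>)"
  proof (intro sum.cong refl arg_cong2[where f="(*)"])
    fix \<gamma>
    have "msign \<beta> \<alpha> * real (mbinom \<beta> \<alpha>) * real (mbinom \<alpha> \<gamma>) =
        (\<Prod>i\<in>UNIV. (- 1) ^ (\<beta> i - \<alpha> i) * real (\<beta> i choose \<alpha> i) * real (\<alpha> i choose \<gamma> i))" for \<alpha>
      by (simp add: msign_def mbinom_def prod.distrib)
    then have "(\<Sum>\<alpha>\<in>{\<alpha>. mindex_le \<alpha> \<beta>}. msign \<beta> \<alpha> * real (mbinom \<beta> \<alpha>) * real (mbinom \<alpha> \<gamma>))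
        = (\<Prod>i\<in>UNIV. of_bool (\<beta> i = \<gamma> i))"
      using sum_prod_mindex_le[of "\<lambda>i j. (- 1) ^ (\<beta> i - j) * real (\<beta> i choose j) * real (j choose \<gamma> i)" \<beta>]
      by (simp add: signed_binomial_orthogonality)
    also have "\<dots> = of_bool (\<gamma> = \<beta>)"
      by (auto simp: fun_eq_iff) metis
    finally show "(\<Sum>\<alpha>\<in>{\<alpha>. mindex_le \<alpha> \<beta>}. msign \<beta> \<alpha> * real (mbinom \<beta> \<alpha>) * real (mbinom \<alpha> \<gamma>)) = of_bool (\<gamma> = \<beta>)" .
  qed
  also have "\<dots> = c \<beta>"
    by (subst sum.remove[OF finite_mindex_le, of \<beta>]) (auto simp: mindex_le_def)
  finally show ?thesis .
qed

lemma poly_eval_eq_sum: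
  assumes "finite S" "\<And>\<alpha>. \<alpha> \<notin> S \<Longrightarrow> p \<alpha> = 0"
  shows "poly_eval p x = (\<Sum>\<alpha>\<in>S. p \<alpha> * xpow x \<alpha>)"
  unfolding poly_eval_def by (rule sum.mono_neutral_left) (use assms in auto)

section \<open>Positivity preserving multipliers\<close>

lemma mbinom_eq_0: "\<not> mindex_le \<beta> \<alpha> \<Longrightarrow> mbinom \<alpha> \<beta> = 0"
  by (auto simp: mindex_le_def mbinom_def not_le)

lemma is_poly_weaken: "is_poly p \<Longrightarrow> (\<And>\<alpha>. p \<alpha> = 0 \<Longrightarrow> q \<alpha> = 0) \<Longrightarrow> is_poly q"
  unfolding is_poly_def by (erule rev_finite_subset) auto

text \<open>Encoding a diagonal operator by its eigenvalues turns composition into the pointwise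
  product. These sequences thus form a cone closed under products and pointwise limits, in which the
  exponential series can be summed.\<close>

definition pos_multiplier :: "(('n::finite) mindex \<Rightarrow> real) \<Rightarrow> bool" where
  "pos_multiplier d \<longleftrightarrow> positivity_preserver (\<lambda>p \<alpha>. d \<alpha> * p \<alpha>)"

lemma poly_eval_multiplier:
  assumes "is_poly p"
  shows "poly_eval (\<lambda>\<alpha>. d \<alpha> * p \<alpha>) x = (\<Sum>\<alpha>\<in>{\<alpha>. p \<alpha> \<noteq> 0}. d \<alpha> * p \<alpha> * xpow x \<alpha>)"
  using assms by (intro poly_eval_eq_sum) (auto simp: is_poly_def)

lemma pos_multiplier_iff:
  "pos_multiplier d \<longleftrightarrow> (\<forall>p x. is_poly p \<and> nonneg_poly p \<longrightarrow>
     0 \<le> (\<Sum>\<alpha>\<in>{\<alpha>. p \<alpha> \<noteq> 0}. d \<alpha> * p \<alpha> * xpow x \<alpha>))"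
  by (auto simp: pos_multiplier_def positivity_preserver_def nonneg_poly_def poly_eval_multiplier)

lemma pos_multiplier_add:
  "pos_multiplier d \<Longrightarrow> pos_multiplier e \<Longrightarrow> pos_multiplier (\<lambda>\<alpha>. d \<alpha> + e \<alpha>)"
  by (simp add: pos_multiplier_iff distrib_right sum.distrib)

lemma pos_multiplier_scale: "pos_multiplier d \<Longrightarrow> 0 \<le> r \<Longrightarrow> pos_multiplier (\<lambda>\<alpha>. r * d \<alpha>)"
  by (simp add: pos_multiplier_iff mult.assoc flip: sum_distrib_left)

lemma pos_multiplier_mult:
  assumes d: "pos_multiplier d" and e: "pos_multiplier e"
  shows "pos_multiplier (\<lambda>\<alpha>. d \<alpha> * e \<alpha>)"
  unfolding pos_multiplier_def positivity_preserver_def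
proof (intro allI impI)
  fix p :: "'a mindex \<Rightarrow> real" assume p: "is_poly p \<and> nonneg_poly p"
  then have "is_poly (\<lambda>\<alpha>. e \<alpha> * p \<alpha>)" by (auto intro: is_poly_weaken)
  moreover have "nonneg_poly (\<lambda>\<alpha>. e \<alpha> * p \<alpha>)"
    using e p unfolding pos_multiplier_def positivity_preserver_def by blast
  ultimately have "nonneg_poly (\<lambda>\<alpha>. d \<alpha> * (e \<alpha> * p \<alpha>))"
    using d unfolding pos_multiplier_def positivity_preserver_def by blast
  then show "nonneg_poly (\<lambda>\<alpha>. d \<alpha> * e \<alpha> * p \<alpha>)" by (simp add: mult.assoc)
qed

lemma pos_multiplier_lim:
  assumes d: "\<And>n. pos_multiplier (d n)" and lim: "\<And>\<alpha>. (\<lambda>n. d n \<alpha>) \<longlonglongrightarrow> e \<alpha>"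
  shows "pos_multiplier e"
  unfolding pos_multiplier_iff
proof (intro allI impI)
  fix p :: "'a mindex \<Rightarrow> real" and x assume p: "is_poly p \<and> nonneg_poly p"
  have "(\<lambda>n. \<Sum>\<alpha>\<in>{\<alpha>. p \<alpha> \<noteq> 0}. d n \<alpha> * p \<alpha> * xpow x \<alpha>)
      \<longlonglongrightarrow> (\<Sum>\<alpha>\<in>{\<alpha>. p \<alpha> \<noteq> 0}. e \<alpha> * p \<alpha> * xpow x \<alpha>)"
    by (intro tendsto_intros lim)
  then show "0 \<le> (\<Sum>\<alpha>\<in>{\<alpha>. p \<alpha> \<noteq> 0}. e \<alpha> * p \<alpha> * xpow x \<alpha>)"
    by (rule LIMSEQ_le_const) (use d p in \<open>auto simp: pos_multiplier_iff\<close>)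
qed

text \<open>The operator substitutes y_i x_i for x_i, and the new polynomial takes only values of
  the old one.\<close>

lemma pos_multiplier_xpow: "pos_multiplier (xpow y)"
  unfolding pos_multiplier_iff
proof (intro allI impI)
  fix p :: "'a mindex \<Rightarrow> real" and x assume p: "is_poly p \<and> nonneg_poly p"
  have "(\<Sum>\<alpha>\<in>{\<alpha>. p \<alpha> \<noteq> 0}. xpow y \<alpha> * p \<alpha> * xpow x \<alpha>) = poly_eval p (\<chi> i. y $ i * x $ i)"
    by (simp add: poly_eval_def xpow_def power_mult_distrib prod.distrib mult_ac)
  with p show "0 \<le> (\<Sum>\<alpha>\<in>{\<alpha>. p \<alpha> \<noteq> 0}. xpow y \<alpha> * p \<alpha> * xpow x \<alpha>)"
    by (simp add: nonneg_poly_def)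
qed

lemma pos_multiplier_const:
  assumes "0 \<le> r" shows "pos_multiplier (\<lambda>_ :: ('n::finite) mindex. r)"
proof -
  have "(\<lambda>_. r) = (\<lambda>\<alpha> :: 'n mindex. r * xpow 1 \<alpha>)" by (simp add: xpow_def)
  then show ?thesis using pos_multiplier_scale[OF pos_multiplier_xpow assms] by metis
qed

lemma pos_multiplier_sum:
  "(\<And>x. x \<in> F \<Longrightarrow> pos_multiplier (d x)) \<Longrightarrow> pos_multiplier (\<lambda>\<alpha>. \<Sum>x\<in>F. d x \<alpha>)"
  by (induction F rule: infinite_finite_induct)
    (auto intro: pos_multiplier_const pos_multiplier_add)

lemma pos_multiplier_power: "pos_multiplier d \<Longrightarrow> pos_multiplier (\<lambda>\<alpha>. d \<alpha> ^ k)"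
  by (induction k) (auto intro: pos_multiplier_const pos_multiplier_mult)

text \<open>The partial sums of the exponential series have non-negative coefficients.\<close>

lemma pos_multiplier_exp:
  assumes "pos_multiplier d" shows "pos_multiplier (\<lambda>\<alpha>. exp (d \<alpha>))"
proof (rule pos_multiplier_lim)
  show "pos_multiplier (\<lambda>\<alpha>. \<Sum>k<n. inverse (fact k) * d \<alpha> ^ k)" for n
    using assms by (intro pos_multiplier_sum pos_multiplier_scale pos_multiplier_power) auto
  show "(\<lambda>n. \<Sum>k<n. inverse (fact k) * d \<alpha> ^ k) \<longlonglongrightarrow> exp (d \<alpha>)" for \<alpha>
    using exp_converges[of "d \<alpha>"] by (simp add: sums_def)
qed

text \<open>Closure, in the topology of coordinatewise convergence, of the cone spanned by the
  moment sequences of points. Orders 0 and 1 are left free; the cut-off d fits the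
  finite-dimensional separation.\<close>

definition point_mass_approximable :: "(('n::finite) mindex \<Rightarrow> real) \<Rightarrow> bool" where
  "point_mass_approximable c \<longleftrightarrow> (\<forall>d. \<forall>\<epsilon>>0. \<exists>F w. finite F \<and> (\<forall>x. 0 \<le> w x) \<and>
     (\<forall>\<beta>. 2 \<le> mabs \<beta> \<and> mabs \<beta> \<le> d \<longrightarrow> \<bar>c \<beta> - (\<Sum>x\<in>F. w x * xpow x \<beta>)\<bar> < \<epsilon>))"

lemma mabs_less_2: "{\<beta> :: ('n::finite) mindex. mabs \<beta> < 2} = insert (\<lambda>_. 0) (range unit_idx)"
proof (rule set_eqI, rule iffI)
  fix \<beta> :: "'n mindex" assume "\<beta> \<in> {\<beta>. mabs \<beta> < 2}"
  then have less: "mabs \<beta> < 2" by simp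
  show "\<beta> \<in> insert (\<lambda>_. 0) (range unit_idx)"
  proof (cases "\<beta> = (\<lambda>_. 0)")
    case False
    then obtain i where i: "\<beta> i \<noteq> 0" by (auto simp: fun_eq_iff)
    have "mabs \<beta> = \<beta> i + (\<Sum>j\<in>UNIV - {i}. \<beta> j)" unfolding mabs_def by (simp add: sum.remove)
    with less i have "\<beta> i = 1" "(\<Sum>j\<in>UNIV - {i}. \<beta> j) = 0" by linarith+
    then have "\<beta> = unit_idx i" by (auto simp: fun_eq_iff unit_idx_def)
    then show ?thesis by simp
  qed simp
next
  fix \<beta> :: "'n mindex" assume "\<beta> \<in> insert (\<lambda>_. 0) (range unit_idx)"
  then show "\<beta> \<in> {\<beta>. mabs \<beta> < 2}" by (auto simp: mabs_def unit_idx_def)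
qed

lemma mbinom_unit_idx: "mbinom \<alpha> (unit_idx i) = \<alpha> i"
proof -
  have "mbinom \<alpha> (unit_idx i) = (\<Prod>j\<in>UNIV. if j = i then \<alpha> i else 1)"
    unfolding mbinom_def unit_idx_def by (intro prod.cong) auto
  then show ?thesis by simp
qed

text \<open>Only the zero index and the unit indices contribute, with binomials 1 and \<alpha> i.
  The exponential of such an eigenvalue is a constant times a monomial in exponentials, that is, a
  scaling of the coordinates.\<close>

lemma diag_eig_affine:
  assumes "\<And>\<beta>. 2 \<le> mabs \<beta> \<Longrightarrow> e \<beta> = 0"
  shows "diag_eig e \<alpha> = e (\<lambda>_. 0) + (\<Sum>i\<in>UNIV. real (\<alpha> i) * e (unit_idx i))"
proof -
  have inj: "inj (unit_idx :: 'a \<Rightarrow> 'a mindex)" by (rule injI) (auto simp: unit_idx_def fun_eq_iff split: if_splits)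
  have "diag_eig e \<alpha> = (\<Sum>\<beta>\<in>{\<beta>. mindex_le \<beta> \<alpha>} \<union> {\<beta>. mabs \<beta> < 2}. real (mbinom \<alpha> \<beta>) * e \<beta>)"
    unfolding diag_eig_def
    by (intro sum.mono_neutral_left) (auto simp: finite_mindex_le mabs_less_2 mbinom_eq_0)
  also have "\<dots> = (\<Sum>\<beta>\<in>{\<beta>. mabs \<beta> < 2}. real (mbinom \<alpha> \<beta>) * e \<beta>)"
    by (intro sum.mono_neutral_right) (auto simp: finite_mindex_le mabs_less_2[symmetric] assms not_less
        intro: finite_subset[OF _ finite_mabs_le[of 2]])
  also have "\<dots> = e (\<lambda>_. 0) + (\<Sum>\<beta>\<in>range unit_idx. real (mbinom \<alpha> \<beta>) * e \<beta>)"
  proof -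
    have "(\<lambda>_. 0) \<notin> range (unit_idx :: 'a \<Rightarrow> 'a mindex)"
      by (auto simp: unit_idx_def fun_eq_iff) (metis zero_neq_one)
    then show ?thesis by (simp add: mabs_less_2 mbinom_def)
  qed
  also have "(\<Sum>\<beta>\<in>range unit_idx. real (mbinom \<alpha> \<beta>) * e \<beta>) = (\<Sum>i\<in>UNIV. real (\<alpha> i) * e (unit_idx i))"
    by (simp add: sum.reindex[OF inj] mbinom_unit_idx)
  finally show ?thesis .
qed

lemma positivity_preserver_if_approximable:
  fixes c :: "('n::finite) mindex \<Rightarrow> real"
  assumes "point_mass_approximable c" "0 \<le> t"
  shows "positivity_preserver (exp_op c t)"
proof -
  have "\<forall>k. \<exists>F w. finite F \<and> (\<forall>x. 0 \<le> w x) \<and> (\<forall>\<beta>. 2 \<le> mabs \<beta> \<and> mabs \<beta> \<le> k \<longrightarrow>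
      \<bar>c \<beta> - (\<Sum>x\<in>F. w x * xpow x \<beta>)\<bar> < inverse (real (Suc k)))"
    using assms(1) unfolding point_mass_approximable_def by auto
  then obtain F w where Fw: "\<forall>k. finite (F k) \<and> (\<forall>x. 0 \<le> w k x) \<and>
      (\<forall>\<beta>. 2 \<le> mabs \<beta> \<and> mabs \<beta> \<le> k \<longrightarrow>
        \<bar>c \<beta> - (\<Sum>x\<in>F k. w k x * xpow x \<beta>)\<bar> < inverse (real (Suc k)))"
    unfolding choice_iff by blast
  then have w: "\<And>k x. 0 \<le> w k x" and approx: "\<And>k \<beta>. 2 \<le> mabs \<beta> \<Longrightarrow> mabs \<beta> \<le> k \<Longrightarrow>
      \<bar>c \<beta> - (\<Sum>x\<in>F k. w k x * xpow x \<beta>)\<bar> < inverse (real (Suc k))" by blast+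
  define m where "m k \<beta> = (\<Sum>x\<in>F k. w k x * xpow x \<beta>)" for k \<beta>
  \<comment> \<open>Keeping c itself in orders 0 and 1 leaves a difference to the point masses that
    lives in these orders only.\<close>
  define ck where "ck k \<beta> = (if 2 \<le> mabs \<beta> then m k \<beta> else c \<beta>)" for k \<beta>
  have "(\<lambda>k. ck k \<beta>) \<longlonglongrightarrow> c \<beta>" for \<beta>
  proof (rule LIM_zero_cancel, rule Lim_null_comparison[OF _ LIMSEQ_inverse_real_of_nat])
    show "\<forall>\<^sub>F k in sequentially. norm (ck k \<beta> - c \<beta>) \<le> inverse (real (Suc k))"
      using eventually_ge_at_top[of "mabs \<beta>"]
      by eventually_elim
        (use approx[of \<beta>] in \<open>auto simp: ck_def m_def abs_minus_commute intro: less_imp_le simp del: of_nat_Suc\<close>)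
  qed
  then have lim: "(\<lambda>k. exp (t * diag_eig (ck k) \<alpha>)) \<longlonglongrightarrow> exp (t * diag_eig c \<alpha>)" for \<alpha>
    unfolding diag_eig_def by (intro tendsto_intros)
  have "pos_multiplier (\<lambda>\<alpha>. exp (t * diag_eig (ck k) \<alpha>))" for k
  proof -
    define e where "e \<beta> = (if 2 \<le> mabs \<beta> then 0 else c \<beta> - m k \<beta>)" for \<beta>
    have split: "diag_eig (ck k) \<alpha> = diag_eig e \<alpha> + diag_eig (m k) \<alpha>" for \<alpha>
      unfolding diag_eig_def sum.distrib[symmetric]
      by (intro sum.cong refl) (auto simp: e_def ck_def algebra_simps)
    have "diag_eig (m k) \<alpha> = (\<Sum>x\<in>F k. w k x * xpow (x + 1) \<alpha>)" for \<alpha>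
      unfolding diag_eig_def m_def sum_distrib_left sum_mbinom_xpow[symmetric]
      by (subst sum.swap) (simp add: mult_ac)
    then have "pos_multiplier (\<lambda>\<alpha>. t * diag_eig (m k) \<alpha>)"
      using w \<open>0 \<le> t\<close> by (auto intro!: pos_multiplier_scale pos_multiplier_sum pos_multiplier_xpow)
    then have pos: "pos_multiplier (\<lambda>\<alpha>. exp (t * diag_eig (m k) \<alpha>))" by (rule pos_multiplier_exp)
    \<comment> \<open>The values of e may have either sign; after exponentiation both the factor and
      the scalings are positive.\<close>
    have "exp (t * diag_eig e \<alpha>) = exp (t * e (\<lambda>_. 0)) * xpow (\<chi> i. exp (t * e (unit_idx i))) \<alpha>" for \<alpha>
    proof -
      have "diag_eig e \<alpha> = e (\<lambda>_. 0) + (\<Sum>i\<in>UNIV. real (\<alpha> i) * e (unit_idx i))"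
        by (rule diag_eig_affine) (simp add: e_def)
      then have "t * diag_eig e \<alpha> = t * e (\<lambda>_. 0) + (\<Sum>i\<in>UNIV. real (\<alpha> i) * (t * e (unit_idx i)))"
        by (simp add: distrib_left sum_distrib_left mult_ac)
      then show ?thesis by (simp add: exp_add exp_sum xpow_def exp_of_nat_mult)
    qed
    then have "pos_multiplier (\<lambda>\<alpha>. exp (t * diag_eig e \<alpha>))"
      by (auto intro: pos_multiplier_scale pos_multiplier_xpow)
    with pos show ?thesis by (simp add: split distrib_left exp_add pos_multiplier_mult)
  qed
  then have "pos_multiplier (\<lambda>\<alpha>. exp (t * diag_eig c \<alpha>))"
    using lim by (rule pos_multiplier_lim)
  then show ?thesis by (simp add: pos_multiplier_def exp_op_def[abs_def])
qed

section \<open>Conditional positivity\<close>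

definition cond_positive :: "(('n::finite) mindex \<Rightarrow> real) \<Rightarrow> bool" where
  "cond_positive c \<longleftrightarrow> (\<forall>q. is_poly q \<and> nonneg_poly q \<and> (\<forall>\<beta>. mabs \<beta> < 2 \<longrightarrow> q \<beta> = 0) \<longrightarrow>
     0 \<le> (\<Sum>\<beta>\<in>{\<beta>. q \<beta> \<noteq> 0}. q \<beta> * c \<beta>))"

lemma cond_positive_if_positivity_preserver:
  assumes pp: "\<And>t. 0 \<le> t \<Longrightarrow> positivity_preserver (exp_op c t)"
  shows "cond_positive c"
  unfolding cond_positive_def
proof (intro allI impI)
  fix q :: "'a mindex \<Rightarrow> real"
  assume q: "is_poly q \<and> nonneg_poly q \<and> (\<forall>\<beta>. mabs \<beta> < 2 \<longrightarrow> q \<beta> = 0)"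
  define Q where "Q = {\<beta>. q \<beta> \<noteq> 0}"
  have "finite Q" using q by (simp add: Q_def is_poly_def)
  define S where "S = (\<Union>\<beta>\<in>Q. {\<alpha>. mindex_le \<alpha> \<beta>})"
  have "finite S" using \<open>finite Q\<close> by (simp add: S_def finite_mindex_le)
  \<comment> \<open>The coefficients of q(y - 1), expanded by the binomial theorem.\<close>
  define p where "p \<alpha> = (\<Sum>\<beta>\<in>Q. q \<beta> * (msign \<beta> \<alpha> * real (mbinom \<beta> \<alpha>)))" for \<alpha>
  have p_out: "p \<alpha> = 0" if "\<alpha> \<notin> S" for \<alpha>
    using that unfolding p_def S_def by (intro sum.neutral) (auto simp: mbinom_eq_0)
  have is_poly: "is_poly p"
    unfolding is_poly_def by (rule finite_subset[OF _ \<open>finite S\<close>]) (use p_out in auto)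
  \<comment> \<open>Pairing p with f equals pairing q with the inverse binomial transform of f. For
    f = \<open>xpow x\<close> this evaluates p; for f = \<open>diag_eig c\<close> it returns
    c.\<close>
  have transfer: "(\<Sum>\<alpha>\<in>S. p \<alpha> * f \<alpha>)
      = (\<Sum>\<beta>\<in>Q. q \<beta> * (\<Sum>\<alpha>\<in>{\<alpha>. mindex_le \<alpha> \<beta>}. msign \<beta> \<alpha> * real (mbinom \<beta> \<alpha>) * f \<alpha>))" for f
  proof -
    have "(\<Sum>\<alpha>\<in>S. p \<alpha> * f \<alpha>) = (\<Sum>\<beta>\<in>Q. q \<beta> * (\<Sum>\<alpha>\<in>S. msign \<beta> \<alpha> * real (mbinom \<beta> \<alpha>) * f \<alpha>))"
      unfolding p_def sum_distrib_right sum_distrib_left by (subst sum.swap) (simp add: mult.assoc)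
    also have "\<dots> = (\<Sum>\<beta>\<in>Q. q \<beta> * (\<Sum>\<alpha>\<in>{\<alpha>. mindex_le \<alpha> \<beta>}. msign \<beta> \<alpha> * real (mbinom \<beta> \<alpha>) * f \<alpha>))"
    proof (rule sum.cong[OF refl], rule arg_cong2[where f="(*)", OF refl])
      fix \<beta> assume "\<beta> \<in> Q"
      then show "(\<Sum>\<alpha>\<in>S. msign \<beta> \<alpha> * real (mbinom \<beta> \<alpha>) * f \<alpha>)
          = (\<Sum>\<alpha>\<in>{\<alpha>. mindex_le \<alpha> \<beta>}. msign \<beta> \<alpha> * real (mbinom \<beta> \<alpha>) * f \<alpha>)"
        using \<open>finite S\<close> by (intro sum.mono_neutral_right) (auto simp: S_def mbinom_eq_0)
    qed
    finally show ?thesis .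
  qed
  have eval: "poly_eval p x = poly_eval q (x - 1)" for x
    by (subst poly_eval_eq_sum[OF \<open>finite S\<close> p_out])
      (simp_all add: transfer sum_signed_mbinom_xpow poly_eval_def Q_def)
  have "nonneg_poly p" using q by (simp add: nonneg_poly_def eval)
  define h where "h t = (\<Sum>\<alpha>\<in>S. p \<alpha> * exp (t * diag_eig c \<alpha>))" for t
  have xpow1: "xpow 1 \<alpha> = 1" for \<alpha> :: "'a mindex" by (simp add: xpow_def)
  have h_nonneg: "0 \<le> h t" if "0 \<le> t" for t
  proof -
    have "nonneg_poly (exp_op c t p)"
      using pp[OF that] is_poly \<open>nonneg_poly p\<close> by (simp add: positivity_preserver_def)
    then have "0 \<le> poly_eval (exp_op c t p) 1" by (simp add: nonneg_poly_def)
    also have "\<dots> = h t"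
      by (subst poly_eval_eq_sum[OF \<open>finite S\<close>])
        (auto simp: exp_op_def p_out h_def xpow1 mult_ac)
    finally show ?thesis .
  qed
  \<comment> \<open>h(0) = p(1,...,1) = q(0) = 0, so h has a minimum over [0, \<infinity>) at the
    end point 0 and its derivative there cannot be negative.\<close>
  have "h 0 = poly_eval p 1"
    by (subst poly_eval_eq_sum[OF \<open>finite S\<close> p_out]) (auto simp: h_def xpow1)
  also have "\<dots> = 0"
  proof -
    have "xpow 0 \<beta> = 0" if "q \<beta> \<noteq> 0" for \<beta>
    proof -
      have "\<beta> \<noteq> (\<lambda>_. 0)" using that q by (auto simp: mabs_def)
      then show ?thesis by (auto simp: xpow_def fun_eq_iff)
    qed
    then show ?thesis by (simp add: eval) (simp add: poly_eval_def)
  qed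
  finally have h0: "h 0 = 0" .
  have deriv: "(h has_real_derivative (\<Sum>\<alpha>\<in>S. p \<alpha> * diag_eig c \<alpha>)) (at 0)"
    unfolding h_def[abs_def] by (auto intro!: derivative_eq_intros sum.cong)
  have "0 \<le> (\<Sum>\<alpha>\<in>S. p \<alpha> * diag_eig c \<alpha>)"
  proof (rule ccontr)
    assume "\<not> ?thesis"
    then obtain d where "0 < d" and d: "\<And>s. 0 < s \<Longrightarrow> s < d \<Longrightarrow> h (0 + s) < h 0"
      using DERIV_neg_dec_right[OF deriv] by auto
    from d[of "d/2"] \<open>0 < d\<close> h0 h_nonneg[of "d/2"] show False by simp
  qed
  also have "\<dots> = (\<Sum>\<beta>\<in>Q. q \<beta> * c \<beta>)" by (simp add: transfer diag_eig_inversion)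
  finally show "0 \<le> (\<Sum>\<beta>\<in>{\<beta>. q \<beta> \<noteq> 0}. q \<beta> * c \<beta>)" by (simp add: Q_def)
qed

lemma approximable_if_cond_positive:
  fixes c :: "('n::finite) mindex \<Rightarrow> real"
  assumes "cond_positive c"
  shows "point_mass_approximable c"
  unfolding point_mass_approximable_def
proof (intro allI impI)
  fix d and \<epsilon> :: real assume "0 < \<epsilon>"
  define S where "S = {\<beta> :: 'n mindex. 2 \<le> mabs \<beta> \<and> mabs \<beta> \<le> d}"
  have "finite S" unfolding S_def by (rule finite_subset[OF _ finite_mabs_le[of d]]) auto
  define C where "C = {u. \<exists>F w. finite F \<and> (\<forall>x. 0 \<le> w x) \<and>
    u = (\<lambda>\<beta> :: 'n mindex. \<Sum>x\<in>F. w x * xpow x \<beta>)}"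
  have "\<exists>u\<in>C. \<forall>\<beta>\<in>S. \<bar>c \<beta> - u \<beta>\<bar> < \<epsilon>"
  proof (rule cone_approximation[OF \<open>finite S\<close>])
    show "(\<lambda>_. 0) \<in> C" unfolding C_def by (intro CollectI exI[of _ "{}"]) auto
  next
    fix u v assume "u \<in> C" "v \<in> C"
    then obtain F w G z where F: "finite F" "\<And>x. 0 \<le> w x" "u = (\<lambda>\<beta>. \<Sum>x\<in>F. w x * xpow x \<beta>)"
      and G: "finite G" "\<And>x. 0 \<le> z x" "v = (\<lambda>\<beta>. \<Sum>x\<in>G. z x * xpow x \<beta>)"
      unfolding C_def by blast
    \<comment> \<open>Weights are extended by zero to the union, so that points common to
      \<open>F\<close> and \<open>G\<close> receive both.\<close>
    let ?y = "\<lambda>x. (if x \<in> F then w x else 0) + (if x \<in> G then z x else 0)"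
    have "u \<beta> = (\<Sum>x\<in>F \<union> G. (if x \<in> F then w x else 0) * xpow x \<beta>)"
      "v \<beta> = (\<Sum>x\<in>F \<union> G. (if x \<in> G then z x else 0) * xpow x \<beta>)" for \<beta>
      unfolding F(3) G(3) using F(1) G(1) by (auto intro!: sum.mono_neutral_cong_left)
    then have "(\<lambda>\<beta>. u \<beta> + v \<beta>) = (\<lambda>\<beta>. \<Sum>x\<in>F \<union> G. ?y x * xpow x \<beta>)"
      by (simp add: distrib_right sum.distrib)
    moreover have "\<forall>x. 0 \<le> ?y x" using F G by auto
    ultimately show "(\<lambda>\<beta>. u \<beta> + v \<beta>) \<in> C"
      unfolding C_def using F(1) G(1) by (intro CollectI exI[of _ "F \<union> G"] exI[of _ ?y]) auto
  next
    fix u and r :: real assume "u \<in> C" "0 \<le> r"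
    then obtain F w where F: "finite F" "\<And>x. 0 \<le> w x" "u = (\<lambda>\<beta>. \<Sum>x\<in>F. w x * xpow x \<beta>)"
      unfolding C_def by blast
    then have "(\<lambda>\<beta>. r * u \<beta>) = (\<lambda>\<beta>. \<Sum>x\<in>F. (r * w x) * xpow x \<beta>)"
      by (simp add: sum_distrib_left mult.assoc)
    moreover have "\<forall>x. 0 \<le> r * w x" using F \<open>0 \<le> r\<close> by auto
    ultimately show "(\<lambda>\<beta>. r * u \<beta>) \<in> C" unfolding C_def using F(1)
      by (intro CollectI exI[of _ F] exI[of _ "\<lambda>x. r * w x"]) auto
  next
    fix q :: "'n mindex \<Rightarrow> real" assume dual: "\<And>u. u \<in> C \<Longrightarrow> 0 \<le> (\<Sum>\<beta>\<in>S. q \<beta> * u \<beta>)"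
    \<comment> \<open>Only the values of q on \<open>S\<close> are tested; cutting off the rest
      yields a polynomial without terms of order below 2.\<close>
    define q' where "q' \<beta> = (if \<beta> \<in> S then q \<beta> else 0)" for \<beta>
    have supp: "{\<beta>. q' \<beta> \<noteq> 0} \<subseteq> S" by (auto simp: q'_def)
    have "is_poly q'" unfolding is_poly_def using supp \<open>finite S\<close> by (rule finite_subset)
    moreover have "nonneg_poly q'"
      unfolding nonneg_poly_def
    proof
      fix x :: "real^'n"
      \<comment> \<open>Testing the dual functional against one unit point mass is evaluating the
        polynomial at that point.\<close>
      have "xpow x \<in> C"
        unfolding C_def by (intro CollectI exI[of _ "{x}"] exI[of _ "\<lambda>_. 1"]) auto
      from dual[OF this] show "0 \<le> poly_eval q' x"
        by (subst poly_eval_eq_sum[OF \<open>finite S\<close>]) (auto simp: q'_def)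
    qed
    moreover have "\<forall>\<beta>. mabs \<beta> < 2 \<longrightarrow> q' \<beta> = 0" by (auto simp: q'_def S_def)
    ultimately have "0 \<le> (\<Sum>\<beta>\<in>{\<beta>. q' \<beta> \<noteq> 0}. q' \<beta> * c \<beta>)"
      using assms by (simp add: cond_positive_def)
    also have "\<dots> = (\<Sum>\<beta>\<in>S. q \<beta> * c \<beta>)"
      using \<open>finite S\<close> supp by (intro sum.mono_neutral_cong_left) (auto simp: q'_def)
    finally show "0 \<le> (\<Sum>\<beta>\<in>S. q \<beta> * c \<beta>)" .
  qed fact
  then obtain u where "u \<in> C" and u: "\<forall>\<beta>\<in>S. \<bar>c \<beta> - u \<beta>\<bar> < \<epsilon>" by blast
  from \<open>u \<in> C\<close> obtain F w where "finite F" "\<forall>x. 0 \<le> w x" "u = (\<lambda>\<beta>. \<Sum>x\<in>F. w x * xpow x \<beta>)"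
    unfolding C_def by blast
  with u show "\<exists>F w. finite F \<and> (\<forall>x. 0 \<le> w x) \<and> (\<forall>\<beta>. 2 \<le> mabs \<beta> \<and> mabs \<beta> \<le> d \<longrightarrow>
      \<bar>c \<beta> - (\<Sum>x\<in>F. w x * xpow x \<beta>)\<bar> < \<epsilon>)"
    by (intro exI[of _ F] exI[of _ w]) (auto simp: S_def)
qed

section \<open>Conditional positivity of the Levy-Khinchin form\<close>

lemma xpow_add: "xpow x (\<lambda>k. \<alpha> k + \<beta> k) = xpow x \<alpha> * xpow x \<beta>"
  by (simp add: xpow_def power_add prod.distrib)

lemma xpow_unit_idx [simp]: "xpow x (unit_idx i) = x $ i"
proof -
  have "xpow x (unit_idx i) = (\<Prod>j\<in>UNIV. if j = i then x $ i else 1)"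
    unfolding xpow_def unit_idx_def by (intro prod.cong) auto
  then show ?thesis by simp
qed

lemma mabs_add: "mabs (\<lambda>k. \<alpha> k + \<beta> k) = mabs \<alpha> + mabs \<beta>"
  by (simp add: mabs_def sum.distrib)

lemma mabs_unit_idx [simp]: "mabs (unit_idx i) = 1"
  by (simp add: mabs_def unit_idx_def)

lemma xpow_scaleR: "xpow (h *\<^sub>R v) \<beta> = h ^ mabs \<beta> * xpow v \<beta>"
  by (simp add: xpow_def mabs_def power_mult_distrib prod.distrib power_sum)

lemma xpow_0: "0 < mabs \<beta> \<Longrightarrow> xpow 0 \<beta> = 0"
  using xpow_scaleR[of 0 1 \<beta>] by (simp add: power_0_left)

lemma borel_measurable_xpow [measurable]: "(\<lambda>x. xpow x \<beta>) \<in> borel_measurable borel"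
  unfolding xpow_def by measurable

lemma mabs_eq_2_cases:
  assumes "mabs \<beta> = 2"
  obtains i j where "\<beta> = (\<lambda>k. unit_idx i k + unit_idx j k)"
proof -
  have "\<beta> \<noteq> (\<lambda>_. 0)" using assms by (auto simp: mabs_def)
  then obtain i where i: "\<beta> i \<noteq> 0" by (auto simp: fun_eq_iff)
  define \<gamma> where "\<gamma> k = \<beta> k - unit_idx i k" for k
  have \<beta>: "\<beta> = (\<lambda>k. unit_idx i k + \<gamma> k)"
    using i by (auto simp: fun_eq_iff \<gamma>_def unit_idx_def)
  have "mabs \<gamma> = 1"
    using assms unfolding \<beta> mabs_add by simp
  then have "\<gamma> \<in> insert (\<lambda>_. 0) (range unit_idx)"
    unfolding mabs_less_2[symmetric] by simp
  moreover have "\<gamma> \<noteq> (\<lambda>_. 0)" using \<open>mabs \<gamma> = 1\<close> by (auto simp: mabs_def)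
  ultimately obtain j where "\<gamma> = unit_idx j" by auto
  with \<beta> show thesis by (intro that[of i j]) simp
qed

text \<open>Cholesky elimination: \<open>I\<close> holds the rows not yet eliminated. A zero pivot
  forces its whole row to vanish; a positive one allows subtracting a rank one matrix, and the Schur
  complement that remains is again positive semi-definite.\<close>

lemma psd_matrix_rank_one_sum_on:
  fixes S :: "real^'n^'n"
  assumes "finite I" "psd_matrix S" "\<And>i j. i \<notin> I \<Longrightarrow> S $ i $ j = 0"
  shows "\<exists>v :: 'n \<Rightarrow> real^'n. \<forall>i j. S $ i $ j = (\<Sum>k\<in>I. v k $ i * v k $ j)"
  using assms
proof (induction I arbitrary: S rule: finite_induct)
  case empty
  then show ?case by auto
next
  case (insert a I)
  have trans: "transpose S = S" and nn: "\<And>w. 0 \<le> w \<bullet> (S *v w)"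
    using insert.prems(1) by (auto simp: psd_matrix_def)
  have sym: "S $ i $ j = S $ j $ i" for i j
    using arg_cong[OF trans, of "\<lambda>A. A $ j $ i"] by (simp add: transpose_def)
  have adj: "w \<bullet> (S *v u) = u \<bullet> (S *v w)" for u w
    by (metis dot_lmul_matrix inner_commute trans vector_transpose_matrix)
  have expand: "(w + t *\<^sub>R axis a 1) \<bullet> (S *v (w + t *\<^sub>R axis a 1))
      = w \<bullet> (S *v w) + 2 * t * (S *v w) $ a + t\<^sup>2 * S $ a $ a" for w t
  proof -
    have "axis a 1 \<bullet> (S *v w) = (S *v w) $ a" for w
      by (simp add: inner_axis' )
    moreover have "(S *v axis a 1) $ a = S $ a $ a"
      by (simp add: matrix_vector_mul_component inner_axis)
    ultimately show ?thesis
      using adj[of w "axis a 1"]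
      by (simp add: matrix_vector_right_distrib inner_add_left inner_add_right power2_eq_square
          matrix_vector_mult_scaleR algebra_simps)
  qed
  show ?case
  proof (cases "S $ a $ a = 0")
    case True
    have "S $ a $ j = 0" for j
    proof (rule ccontr)
      assume ne: "S $ a $ j \<noteq> 0"
      let ?w = "axis j 1 :: real^'n"
      \<comment> \<open>With a zero pivot the quadratic form is affine in t; this t gives it the
        value -1.\<close>
      define t where "t = - (?w \<bullet> (S *v ?w) + 1) / (2 * S $ a $ j)"
      have "(S *v ?w) $ a = S $ a $ j" by (simp add: matrix_vector_mul_component inner_axis)
      then have "(?w + t *\<^sub>R axis a 1) \<bullet> (S *v (?w + t *\<^sub>R axis a 1)) = - 1"
        unfolding expand True t_def using ne by (simp add: field_simps)
      with nn show False by (metis not_one_le_zero neg_0_le_iff_le)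
    qed
    then have "\<exists>v :: 'n \<Rightarrow> real^'n. \<forall>i j. S $ i $ j = (\<Sum>k\<in>I. v k $ i * v k $ j)"
      using insert.prems by (intro insert.IH) (auto, metis)
    then obtain v :: "'n \<Rightarrow> real^'n" where v: "\<And>i j. S $ i $ j = (\<Sum>k\<in>I. v k $ i * v k $ j)"
      by blast
    have "(\<Sum>k\<in>insert a I. (v(a := 0)) k $ i * (v(a := 0)) k $ j) = S $ i $ j" for i j
      unfolding v using insert.hyps by (subst sum.insert) (auto intro!: sum.cong)
    then show ?thesis by metis
  next
    case False
    have pos: "0 < S $ a $ a"
      using expand[of 0 1] nn[of "0 + 1 *\<^sub>R axis a 1"] False by simp
    \<comment> \<open>One step of the Cholesky decomposition.\<close>
    define T :: "real^'n^'n" where "T = (\<chi> i j. S $ i $ j - S $ i $ a * S $ a $ j / S $ a $ a)"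
    have Tmul: "(T *v w) $ i = (S *v w) $ i - S $ i $ a * (S *v w) $ a / S $ a $ a" for w i
      by (simp add: T_def matrix_vector_mult_def left_diff_distrib sum_subtractf
          sum_distrib_left sum_divide_distrib mult.assoc)
    have "psd_matrix T"
      unfolding psd_matrix_def
    proof (intro conjI allI)
      show "transpose T = T"
        by (simp add: transpose_def T_def vec_eq_iff) (metis sym mult.commute)
      fix w
      have "w \<bullet> (T *v w) = w \<bullet> (S *v w) - (\<Sum>i\<in>UNIV. w $ i * S $ i $ a) * (S *v w) $ a / S $ a $ a"
        by (simp add: inner_vec_def Tmul right_diff_distrib sum_subtractf
            sum_distrib_right sum_divide_distrib mult.assoc)
      also have "(\<Sum>i\<in>UNIV. w $ i * S $ i $ a) = (S *v w) $ a"
        by (simp add: matrix_vector_mult_def) (metis sym mult.commute)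
      \<comment> \<open>Completing the square: the Schur complement is the minimum over t of the
        form of S at w + t e_a, attained at t = -(S w)_a / S_aa.\<close>
      also have "w \<bullet> (S *v w) - (S *v w) $ a * (S *v w) $ a / S $ a $ a
          = (w + (- (S *v w) $ a / S $ a $ a) *\<^sub>R axis a 1) \<bullet>
            (S *v (w + (- (S *v w) $ a / S $ a $ a) *\<^sub>R axis a 1))"
        unfolding expand using False by (simp add: power2_eq_square field_simps)
      also have "\<dots> \<ge> 0" by (rule nn)
      finally show "0 \<le> w \<bullet> (T *v w)" .
    qed
    moreover have "T $ i $ j = 0" if "i \<notin> I" for i j
      using that insert.prems(2)[of i] False by (cases "i = a") (auto simp: T_def)
    ultimately have "\<exists>v :: 'n \<Rightarrow> real^'n. \<forall>i j. T $ i $ j = (\<Sum>k\<in>I. v k $ i * v k $ j)"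
      by (intro insert.IH) auto
    then obtain v :: "'n \<Rightarrow> real^'n" where v: "\<And>i j. T $ i $ j = (\<Sum>k\<in>I. v k $ i * v k $ j)"
      by blast
    define u where "u = (\<chi> i. S $ i $ a / sqrt (S $ a $ a))"
    have "(\<Sum>k\<in>insert a I. (v(a := u)) k $ i * (v(a := u)) k $ j) = S $ i $ j" for i j
    proof -
      have "(\<Sum>k\<in>insert a I. (v(a := u)) k $ i * (v(a := u)) k $ j) = u $ i * u $ j + T $ i $ j"
        unfolding v using insert.hyps by (subst sum.insert) (auto intro!: sum.cong)
      also have "u $ i * u $ j = S $ i $ a * S $ a $ j / S $ a $ a"
        using pos by (simp add: u_def sym[of j a])
      finally show ?thesis by (simp add: T_def)
    qed
    then show ?thesis by metis
  qed
qed

lemma psd_matrix_rank_one_sum: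
  fixes S :: "real^'n^'n"
  assumes "psd_matrix S"
  obtains v :: "'n \<Rightarrow> real^'n" where "\<And>i j. S $ i $ j = (\<Sum>k\<in>UNIV. v k $ i * v k $ j)"
  using psd_matrix_rank_one_sum_on[of UNIV S] assms by auto

text \<open>Without terms of order 0 and 1, q(h v) / h^2 is non-negative and tends to the quadratic
  part at v as h tends to 0.\<close>

lemma quadratic_part_nonneg:
  assumes q: "is_poly q" "nonneg_poly q" "\<And>\<beta>. mabs \<beta> < 2 \<Longrightarrow> q \<beta> = 0"
  shows "0 \<le> (\<Sum>\<beta>\<in>{\<beta>. q \<beta> \<noteq> 0}. q \<beta> * (of_bool (mabs \<beta> = 2) * xpow v \<beta>))"
proof (rule LIMSEQ_le_const)
  let ?h = "\<lambda>n. inverse (real (Suc n))"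
  have "(\<lambda>n. ?h n ^ m) \<longlonglongrightarrow> of_bool (m = 0)" for m
    using tendsto_power[OF LIMSEQ_inverse_real_of_nat, of m] by (cases m) auto
  then show "(\<lambda>n. \<Sum>\<beta>\<in>{\<beta>. q \<beta> \<noteq> 0}. q \<beta> * (?h n ^ (mabs \<beta> - 2) * xpow v \<beta>))
      \<longlonglongrightarrow> (\<Sum>\<beta>\<in>{\<beta>. q \<beta> \<noteq> 0}. q \<beta> * (of_bool (mabs \<beta> = 2) * xpow v \<beta>))"
  proof (intro tendsto_sum tendsto_mult tendsto_const)
    fix \<beta> assume "\<beta> \<in> {\<beta>. q \<beta> \<noteq> 0}"
    then have "2 \<le> mabs \<beta>" using q(3) not_less by blast
    then have "of_bool (mabs \<beta> = 2) = (of_bool (mabs \<beta> - 2 = 0) :: real)" by auto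
    then show "(\<lambda>n. ?h n ^ (mabs \<beta> - 2)) \<longlonglongrightarrow> of_bool (mabs \<beta> = 2)"
      using \<open>\<And>m. (\<lambda>n. ?h n ^ m) \<longlonglongrightarrow> of_bool (m = 0)\<close> by metis
  qed
  have "0 \<le> (\<Sum>\<beta>\<in>{\<beta>. q \<beta> \<noteq> 0}. q \<beta> * (h ^ (mabs \<beta> - 2) * xpow v \<beta>))" if "0 < h" for h :: real
  proof -
    have "0 \<le> poly_eval q (h *\<^sub>R v) / h\<^sup>2"
      using q(2) by (simp add: nonneg_poly_def)
    also have "\<dots> = (\<Sum>\<beta>\<in>{\<beta>. q \<beta> \<noteq> 0}. q \<beta> * (h ^ (mabs \<beta> - 2) * xpow v \<beta>))"
      unfolding poly_eval_def sum_divide_distrib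
    proof (intro sum.cong refl)
      fix \<beta> assume "\<beta> \<in> {\<beta>. q \<beta> \<noteq> 0}"
      then have "2 \<le> mabs \<beta>" using q(3) not_less by blast
      then have "h ^ mabs \<beta> = h ^ (mabs \<beta> - 2) * h\<^sup>2" by (metis le_add_diff_inverse2 power_add)
      then show "q \<beta> * xpow (h *\<^sub>R v) \<beta> / h\<^sup>2 = q \<beta> * (h ^ (mabs \<beta> - 2) * xpow v \<beta>)"
        using that by (simp add: xpow_scaleR)
    qed
    finally show ?thesis .
  qed
  then show "\<exists>N. \<forall>n\<ge>N. 0 \<le> (\<Sum>\<beta>\<in>{\<beta>. q \<beta> \<noteq> 0}. q \<beta> * (?h n ^ (mabs \<beta> - 2) * xpow v \<beta>))"
    by simp
qed

text \<open>On orders at least 2, c splits into functionals q -> quadratic part of q at v k and the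
  functional q -> integral of q over \<open>\<nu>\<close>, each non-negative on the admissible
  q.\<close>

lemma cond_positive_if_Levy_Khinchin:
  fixes c :: "('n::finite) mindex \<Rightarrow> real" and S :: "real^'n^'n"
  assumes psd: "psd_matrix S" and sets: "sets \<nu> = sets borel"
    and fin: "\<And>\<alpha>. 2 \<le> mabs \<alpha> \<Longrightarrow> (\<integral>\<^sup>+ x. ennreal \<bar>xpow x \<alpha>\<bar> \<partial>\<nu>) < \<infinity>"
    and c2: "\<And>i j. c (\<lambda>k. unit_idx i k + unit_idx j k)
      = S $ i $ j + (LINT x|\<nu>. xpow x (\<lambda>k. unit_idx i k + unit_idx j k))"
    and c3: "\<And>\<alpha>. 3 \<le> mabs \<alpha> \<Longrightarrow> c \<alpha> = (LINT x|\<nu>. xpow x \<alpha>)"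
  shows "cond_positive c"
  unfolding cond_positive_def
proof (intro allI impI)
  fix q :: "'n mindex \<Rightarrow> real"
  assume q: "is_poly q \<and> nonneg_poly q \<and> (\<forall>\<beta>. mabs \<beta> < 2 \<longrightarrow> q \<beta> = 0)"
  define Q where "Q = {\<beta>. q \<beta> \<noteq> 0}"
  have Q: "finite Q" "\<And>\<beta>. \<beta> \<in> Q \<Longrightarrow> 2 \<le> mabs \<beta>"
    using q by (auto simp: Q_def is_poly_def not_less[symmetric])
  obtain v :: "'n \<Rightarrow> real^'n" where v: "\<And>i j. S $ i $ j = (\<Sum>k\<in>UNIV. v k $ i * v k $ j)"
    using psd_matrix_rank_one_sum[OF psd] by blast
  have c: "c \<beta> = (\<Sum>k\<in>UNIV. of_bool (mabs \<beta> = 2) * xpow (v k) \<beta>) + (LINT x|\<nu>. xpow x \<beta>)"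
    if "\<beta> \<in> Q" for \<beta>
  proof (cases "mabs \<beta> = 2")
    case True
    then obtain i j where \<beta>: "\<beta> = (\<lambda>k. unit_idx i k + unit_idx j k)" by (rule mabs_eq_2_cases)
    show ?thesis unfolding \<beta> c2 by (simp add: mabs_add xpow_add v)
  next
    case False
    with Q(2)[OF that] show ?thesis by (simp add: c3)
  qed
  have int: "integrable \<nu> (\<lambda>x. xpow x \<beta>)" if "\<beta> \<in> Q" for \<beta>
  proof (rule integrableI_bounded)
    show "(\<lambda>x. xpow x \<beta>) \<in> borel_measurable \<nu>"
      using sets borel_measurable_xpow measurable_cong_sets by blast
  qed (use fin Q(2)[OF that] in simp)
  have "(\<Sum>\<beta>\<in>Q. q \<beta> * c \<beta>)
      = (\<Sum>\<beta>\<in>Q. (\<Sum>k\<in>UNIV. q \<beta> * (of_bool (mabs \<beta> = 2) * xpow (v k) \<beta>))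
          + q \<beta> * (LINT x|\<nu>. xpow x \<beta>))"
    by (intro sum.cong refl) (simp only: c distrib_left sum_distrib_left)
  also have "\<dots> = (\<Sum>\<beta>\<in>Q. \<Sum>k\<in>UNIV. q \<beta> * (of_bool (mabs \<beta> = 2) * xpow (v k) \<beta>))
      + (\<Sum>\<beta>\<in>Q. q \<beta> * (LINT x|\<nu>. xpow x \<beta>))"
    by (rule sum.distrib)
  also have "(\<Sum>\<beta>\<in>Q. \<Sum>k\<in>UNIV. q \<beta> * (of_bool (mabs \<beta> = 2) * xpow (v k) \<beta>))
      = (\<Sum>k\<in>UNIV. \<Sum>\<beta>\<in>Q. q \<beta> * (of_bool (mabs \<beta> = 2) * xpow (v k) \<beta>))"
    by (rule sum.swap)
  also have "(\<Sum>\<beta>\<in>Q. q \<beta> * (LINT x|\<nu>. xpow x \<beta>)) = (LINT x|\<nu>. poly_eval q x)"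
    unfolding poly_eval_def Q_def[symmetric] using int by (simp add: Bochner_Integration.integral_sum)
  also have "(\<Sum>k\<in>UNIV. \<Sum>\<beta>\<in>Q. q \<beta> * (of_bool (mabs \<beta> = 2) * xpow (v k) \<beta>)) + \<dots> \<ge> 0"
    unfolding Q_def using q
    by (intro add_nonneg_nonneg sum_nonneg quadratic_part_nonneg Bochner_Integration.integral_nonneg)
      (auto simp: nonneg_poly_def)
  finally show "0 \<le> (\<Sum>\<beta>\<in>{\<beta>. q \<beta> \<noteq> 0}. q \<beta> * c \<beta>)" by (simp add: Q_def)
qed

section \<open>From point masses to the Levy-Khinchin form\<close>

lemma real_distribution_distr_point_measure:
  fixes p :: "'a \<Rightarrow> real" and s :: "'a \<Rightarrow> real"
  assumes A: "finite A" "\<And>x. x \<in> A \<Longrightarrow> 0 \<le> p x" "sum p A = 1"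
  shows "real_distribution (distr (point_measure A p) borel s)"
proof -
  have "emeasure (point_measure A p) (space (point_measure A p)) = 1"
    using A by (simp add: space_point_measure emeasure_point_measure_finite sum_ennreal)
  then have "prob_space (point_measure A p)" by (rule prob_spaceI)
  then have "prob_space (distr (point_measure A p) borel s)"
    by (rule prob_space.prob_space_distr) (simp add: measurable_point_measure_eq1)
  then show ?thesis
    by (auto simp: real_distribution_def real_distribution_axioms_def)
qed

lemma integral_distr_point_measure:
  fixes p :: "'a \<Rightarrow> real" and s g :: "_ \<Rightarrow> real"
  assumes A: "finite A" "\<And>x. x \<in> A \<Longrightarrow> 0 \<le> p x" and g: "g \<in> borel_measurable borel"
  shows "integrable (distr (point_measure A p) borel s) g"
    and "integral\<^sup>L (distr (point_measure A p) borel s) g = (\<Sum>x\<in>A. p x * g (s x))"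
proof -
  have s: "s \<in> measurable (point_measure A p) borel" by (simp add: measurable_point_measure_eq1)
  show "integrable (distr (point_measure A p) borel s) g"
    using A by (subst integrable_distr_eq[OF s g]) (rule integrable_point_measure_finite)
  show "integral\<^sup>L (distr (point_measure A p) borel s) g = (\<Sum>x\<in>A. p x * g (s x))"
    using A by (subst integral_distr[OF s g]) (simp add: lebesgue_integral_point_measure_finite)
qed

lemma tight_if_supported_in_unit_interval:
  assumes \<mu>: "\<And>k. real_distribution (\<mu> k)" and supp: "\<And>k. AE s in \<mu> k. s \<in> {0..1}"
  shows "tight \<mu>"
  unfolding tight_def
proof (intro conjI allI impI \<mu>)
  fix \<epsilon> :: real assume "0 < \<epsilon>"
  \<comment> \<open>The interval is open on the left, so it starts below 0 to include a possible
    atom there.\<close>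
  have "measure (\<mu> k) {-1<..1} = 1" for k
  proof -
    interpret real_distribution "\<mu> k" by (rule \<mu>)
    have "AE s in \<mu> k. s \<in> {-1<..1}" using supp by (rule eventually_mono) auto
    then show ?thesis by (subst prob_eq_1) auto
  qed
  then show "\<exists>a b. a < b \<and> (\<forall>k. 1 - \<epsilon> < measure (\<mu> k) {a<..b})"
    using \<open>0 < \<epsilon>\<close> by (intro exI[of _ "-1"] exI[of _ 1]) auto
qed

lemma abs_xpow_le_1:
  assumes "\<And>i. \<bar>z $ i\<bar> \<le> 1" shows "\<bar>xpow z \<beta>\<bar> \<le> 1"
  unfolding xpow_def abs_prod power_abs using assms by (intro prod_le_1) (auto simp: power_le_one)

lemma power2_norm_eq_sum_xpow: "(norm x)\<^sup>2 = (\<Sum>i\<in>UNIV. xpow x (\<lambda>k. unit_idx i k + unit_idx i k))"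
  by (simp add: power2_norm_eq_inner inner_vec_def xpow_add)

text \<open>From 1 - y = y |x|^2 follows sqrt (y (1 - y)) / y = |x|. Writing the radial power this
  way isolates the pole y^-(m - 2), leaving a numerator that is continuous and bounded by 1 up to y
  = 0.\<close>

lemma polar_power_identity:
  fixes x :: "real^'n"
  assumes y: "y = 1 / (1 + (norm x)\<^sup>2)" and \<beta>: "2 \<le> mabs \<beta>"
  shows "(norm x)\<^sup>2 * (sqrt (y * (1 - y)) ^ (mabs \<beta> - 2) * xpow (sgn x) \<beta> / y ^ (mabs \<beta> - 2)) = xpow x \<beta>"
proof -
  have p: "0 < 1 + (norm x)\<^sup>2" by (simp add: add_pos_nonneg)
  have "y * (1 - y) = (norm x / (1 + (norm x)\<^sup>2))\<^sup>2"
    using p unfolding y by (simp add: field_simps power2_eq_square)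
  then have "sqrt (y * (1 - y)) / y = norm x"
    using p unfolding y by simp
  then have "sqrt (y * (1 - y)) ^ (mabs \<beta> - 2) / y ^ (mabs \<beta> - 2) = norm x ^ (mabs \<beta> - 2)"
    by (metis power_divide)
  then have "(norm x)\<^sup>2 * (sqrt (y * (1 - y)) ^ (mabs \<beta> - 2) * xpow (sgn x) \<beta> / y ^ (mabs \<beta> - 2))
      = (norm x)\<^sup>2 * norm x ^ (mabs \<beta> - 2) * xpow (sgn x) \<beta>"
    by (metis (no_types, lifting) mult.assoc times_divide_eq_left)
  also have "\<dots> = norm x ^ mabs \<beta> * xpow (sgn x) \<beta>"
    using \<beta> by (metis le_add_diff_inverse power_add)
  also have "\<dots> = xpow x \<beta>"
  proof -
    have "norm x *\<^sub>R sgn x = x" by (cases "x = 0") (auto simp: sgn_div_norm)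
    then show ?thesis unfolding xpow_scaleR[symmetric] by simp
  qed
  finally show ?thesis .
qed

lemma abs_polar_le_1:
  assumes "0 \<le> y" "y \<le> 1" "\<And>i. \<bar>z $ i\<bar> \<le> 1"
  shows "\<bar>sqrt (y * (1 - y)) ^ k * xpow z \<beta>\<bar> \<le> 1"
proof -
  have "y * (1 - y) \<le> 1" using assms(1,2) by (intro mult_le_one) auto
  then have "\<bar>sqrt (y * (1 - y)) ^ k\<bar> \<le> 1"
    using assms(1,2) by (auto simp: power_abs intro!: power_le_one)
  then show ?thesis
    unfolding abs_mult using assms(3) by (intro mult_le_one abs_xpow_le_1) auto
qed

text \<open>The compactness step. The measures \<open>\<mu> k\<close> reproduce the approximating
  moments exactly, up to the factor \<open>M\<close>, and
  \<open>weak_limit_singular_integral\<close> passes to the limit. What is retained about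
  \<open>\<omega>\<close> is membership in the box, not unit length.\<close>

lemma polar_integral_representation:
  fixes c :: "('n::finite) mindex \<Rightarrow> real"
  assumes "point_mass_approximable c"
  obtains M P \<theta> and \<omega> :: "real \<Rightarrow> real^'n" where "0 < M" "real_distribution P"
    "continuous_on UNIV \<theta>" "\<And>s. 0 \<le> \<theta> s" "\<And>s. \<theta> s \<le> 1"
    "continuous_on UNIV \<omega>" "\<And>s i. \<bar>\<omega> s $ i\<bar> \<le> 1"
    "AE s in P. 0 < \<theta> s" "\<And>k. integrable P (\<lambda>s. 1 / \<theta> s ^ k)"
    "\<And>\<beta>. 2 \<le> mabs \<beta> \<Longrightarrow> c \<beta> = M * (\<integral>s. sqrt (\<theta> s * (1 - \<theta> s)) ^ (mabs \<beta> - 2)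
        * xpow (\<omega> s) \<beta> / \<theta> s ^ (mabs \<beta> - 2) \<partial>P)"
proof -
  \<comment> \<open>Order k + 2 ensures that second moments are within 1 of c for every k, including
    k = 0; this gives the uniform mass bound \<open>M\<close>.\<close>
  have "\<forall>k. \<exists>F w. finite F \<and> (\<forall>x. 0 \<le> w x) \<and> (\<forall>\<beta>. 2 \<le> mabs \<beta> \<and> mabs \<beta> \<le> k + 2 \<longrightarrow>
      \<bar>c \<beta> - (\<Sum>x\<in>F. w x * xpow x \<beta>)\<bar> < inverse (real (Suc k)))"
    using assms(1) unfolding point_mass_approximable_def by auto
  then obtain F w where Fw: "\<forall>k. finite (F k) \<and> (\<forall>x. 0 \<le> w k x) \<and>
      (\<forall>\<beta>. 2 \<le> mabs \<beta> \<and> mabs \<beta> \<le> k + 2 \<longrightarrow>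
        \<bar>c \<beta> - (\<Sum>x\<in>F k. w k x * xpow x \<beta>)\<bar> < inverse (real (Suc k)))"
    unfolding choice_iff by blast
  define L where "L k f = (\<Sum>x\<in>F k. w k x * f x)" for k and f :: "real^'n \<Rightarrow> real"
  have F: "finite (F k)" and w: "0 \<le> w k x"
    and approx: "2 \<le> mabs \<beta> \<Longrightarrow> mabs \<beta> \<le> k + 2 \<Longrightarrow>
      \<bar>c \<beta> - L k (\<lambda>x. xpow x \<beta>)\<bar> < inverse (real (Suc k))" for k x \<beta>
    using Fw unfolding L_def by blast+
  have L_sum: "L k (\<lambda>x. \<Sum>i\<in>I. f i x) = (\<Sum>i\<in>I. L k (f i))" for k I and f :: "'n \<Rightarrow> real^'n \<Rightarrow> real"
    unfolding L_def sum_distrib_left by (rule sum.swap)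
  have L_add: "L k (\<lambda>x. f x + g x) = L k f + L k g" for k f g
    by (simp add: L_def distrib_left sum.distrib)
  have Lconv: "(\<lambda>k. L k (\<lambda>x. xpow x \<beta>)) \<longlonglongrightarrow> c \<beta>" if "2 \<le> mabs \<beta>" for \<beta>
  proof (rule LIM_zero_cancel, rule Lim_null_comparison[OF _ LIMSEQ_inverse_real_of_nat])
    show "\<forall>\<^sub>F k in sequentially. norm (L k (\<lambda>x. xpow x \<beta>) - c \<beta>) \<le> inverse (real (Suc k))"
      using eventually_ge_at_top[of "mabs \<beta>"]
    proof eventually_elim
      case (elim k)
      then show ?case using approx[of \<beta> k] that by (simp add: abs_minus_commute del: of_nat_Suc)
    qed
  qed
  define sq :: "'n \<Rightarrow> 'n mindex" where "sq i = (\<lambda>k. unit_idx i k + unit_idx i k)" for i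
  have norm_sq: "(norm x)\<^sup>2 = (\<Sum>i\<in>UNIV. xpow x (sq i))" for x :: "real^'n"
    by (simp add: power2_norm_eq_sum_xpow sq_def)
  have mabs_sq: "mabs (sq i) = 2" for i by (simp add: sq_def mabs_add)
  \<comment> \<open>Every |\<beta>| \<ge> 2 moment converges, so the integrals of 1 / \<theta> ^ j = (1 + |x|^2) ^ j stay bounded.\<close>
  have growth: "convergent (\<lambda>k. L k (\<lambda>x. xpow x \<beta> * (1 + (norm x)\<^sup>2) ^ j))" if "2 \<le> mabs \<beta>" for \<beta> j
    using that
  proof (induction j arbitrary: \<beta>)
    case 0
    then show ?case using Lconv by (auto simp: convergent_def)
  next
    case (Suc j)
    let ?g = "\<lambda>x. (1 + (norm x)\<^sup>2) ^ j"
    \<comment> \<open>Multiplication by |x|^2 replaces \<beta> by \<beta> + 2 e_i and sums over i,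
      so the induction has to run over all \<beta> at once.\<close>
    have "xpow x \<beta> * (1 + (norm x)\<^sup>2) ^ Suc j
        = xpow x \<beta> * ?g x + (\<Sum>i\<in>UNIV. xpow x (\<lambda>k. \<beta> k + sq i k) * ?g x)" for x
    proof -
      have "xpow x \<beta> * (1 + (norm x)\<^sup>2) ^ Suc j = xpow x \<beta> * ?g x + (norm x)\<^sup>2 * (xpow x \<beta> * ?g x)"
        by (simp add: algebra_simps)
      also have "(norm x)\<^sup>2 * (xpow x \<beta> * ?g x) = (\<Sum>i\<in>UNIV. xpow x (sq i) * (xpow x \<beta> * ?g x))"
        by (subst norm_sq) (rule sum_distrib_right)
      finally show ?thesis by (simp add: xpow_add mult_ac)
    qed
    then have "L k (\<lambda>x. xpow x \<beta> * (1 + (norm x)\<^sup>2) ^ Suc j) = L k (\<lambda>x. xpow x \<beta> * ?g x)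
        + (\<Sum>i\<in>UNIV. L k (\<lambda>x. xpow x (\<lambda>k. \<beta> k + sq i k) * ?g x))" for k
      by (simp only: L_add L_sum)
    then show ?case
      using Suc.IH Suc.prems by (simp only:) (intro convergent_add convergent_sum Suc.IH; simp add: mabs_add)
  qed
  \<comment> \<open>The point 0, where \<omega> = sgn 0 = 0, absorbs the mass missing from a probability
    measure; it contributes nothing to moments of order at least 2.\<close>
  define M where "M = (\<Sum>i\<in>UNIV. \<bar>c (sq i)\<bar> + 1)"
  have "0 < M" unfolding M_def by (intro sum_pos) auto
  define mass where "mass k = L k (\<lambda>x. (norm x)\<^sup>2)" for k
  have mass_M: "mass k \<le> M" for k
    unfolding mass_def norm_sq L_sum M_def
  proof (rule sum_mono)
    fix i
    have "\<bar>c (sq i) - L k (\<lambda>x. xpow x (sq i))\<bar> < inverse (real (Suc k))"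
      by (rule approx) (simp_all add: mabs_sq)
    also have "\<dots> \<le> 1" by (simp add: inverse_le_1_iff)
    finally show "L k (\<lambda>x. xpow x (sq i)) \<le> \<bar>c (sq i)\<bar> + 1" by linarith
  qed
  define A where "A k = insert 0 (F k)" for k
  define p where "p k x = (if x = 0 then 1 - mass k / M else w k x * (norm x)\<^sup>2 / M)" for k x
  have A: "finite (A k)" for k by (simp add: A_def F)
  have p0: "0 \<le> p k x" for k x
    using \<open>0 < M\<close> mass_M[of k] w by (auto simp: p_def)
  have p_sum: "(\<Sum>x\<in>A k. p k x * g x) = (1 - mass k / M) * g 0 + L k (\<lambda>x. (norm x)\<^sup>2 * g x) / M"
    for k and g :: "real^'n \<Rightarrow> real"
  proof -
    have "(\<Sum>x\<in>A k. p k x * g x) = p k 0 * g 0 + (\<Sum>x\<in>F k - {0}. p k x * g x)"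
      unfolding A_def by (rule sum.insert_remove[OF F])
    also have "(\<Sum>x\<in>F k - {0}. p k x * g x) = (\<Sum>x\<in>F k. w k x * ((norm x)\<^sup>2 * g x) / M)"
      by (rule sum.mono_neutral_cong_left) (use F in \<open>auto simp: p_def\<close>)
    also have "\<dots> = L k (\<lambda>x. (norm x)\<^sup>2 * g x) / M" by (simp add: L_def sum_divide_distrib)
    finally show ?thesis by (simp add: p_def)
  qed
  have p1: "sum (p k) (A k) = 1" for k
    using p_sum[of k "\<lambda>_. 1"] \<open>0 < M\<close> by (simp add: mass_def)
  obtain \<theta> :: "real \<Rightarrow> real" and \<omega> :: "real \<Rightarrow> real^'n" where
    \<theta>: "continuous_on UNIV \<theta>" "\<And>s. 0 \<le> \<theta> s" "\<And>s. \<theta> s \<le> 1"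
    and \<omega>: "continuous_on UNIV \<omega>" "\<And>s i. \<bar>\<omega> s $ i\<bar> \<le> 1"
    and surj: "\<And>y z. 0 \<le> y \<Longrightarrow> y \<le> 1 \<Longrightarrow> (\<And>i. \<bar>z $ i\<bar> \<le> 1) \<Longrightarrow> \<exists>s\<in>{0..1}. \<theta> s = y \<and> \<omega> s = z"
    by (rule continuous_surjection_box) blast
  have "\<exists>s. s \<in> {0..1} \<and> \<theta> s = 1 / (1 + (norm x)\<^sup>2) \<and> \<omega> s = sgn x" for x :: "real^'n"
  proof -
    have "\<bar>sgn x $ i\<bar> \<le> 1" for i
      using component_le_norm_cart[of "sgn x" i] by (simp add: norm_sgn split: if_splits)
    then show ?thesis using surj[of "1 / (1 + (norm x)\<^sup>2)" "sgn x"] by (auto simp: field_simps add_pos_nonneg)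
  qed
  then obtain \<sigma> where \<sigma>: "\<And>x. \<sigma> x \<in> {0..1}" "\<And>x. \<theta> (\<sigma> x) = 1 / (1 + (norm x)\<^sup>2)"
      "\<And>x. \<omega> (\<sigma> x) = sgn (x :: real^'n)"
    by metis
  \<comment> \<open>\<open>\<sigma>\<close> is an arbitrary choice of preimages under the curve;
    every map is measurable on a point measure.\<close>
  define \<mu> where "\<mu> k = distr (point_measure (A k) (p k)) borel \<sigma>" for k
  have \<mu>: "real_distribution (\<mu> k)" for k
    unfolding \<mu>_def by (rule real_distribution_distr_point_measure[OF A p0 p1])
  have \<mu>_int: "integrable (\<mu> k) g" "integral\<^sup>L (\<mu> k) g = (\<Sum>x\<in>A k. p k x * g (\<sigma> x))"
    if "g \<in> borel_measurable borel" for g k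
    unfolding \<mu>_def by (rule integral_distr_point_measure[OF A p0 that])+
  have \<mu>_AE: "AE s in \<mu> k. Q s" if "{s. Q s} \<in> sets borel" "\<And>x. Q (\<sigma> x)" for Q k
    unfolding \<mu>_def using that by (subst AE_distr_iff) (auto simp: AE_point_measure measurable_point_measure_eq1)
  have \<theta>m [measurable]: "\<theta> \<in> borel_measurable borel"
    using \<theta>(1) by (rule borel_measurable_continuous_onI)
  have "tight \<mu>"
    by (rule tight_if_supported_in_unit_interval[OF \<mu>], rule \<mu>_AE) (use \<sigma> in auto)
  from tight_imp_convergent_subsubsequence[OF this strict_mono_id]
  obtain r P where r: "strict_mono (r :: nat \<Rightarrow> nat)" and P: "real_distribution P"
    and conv: "weak_conv_m (\<mu> \<circ> id \<circ> r) P" by blast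
  have conv: "weak_conv_m (\<lambda>k. \<mu> (r k)) P" using conv by (simp add: comp_def)
  have pos: "AE s in \<mu> k. 0 < \<theta> s" for k
    by (rule \<mu>_AE) (auto simp: \<sigma> add_pos_nonneg)
  have int: "integrable (\<mu> k) (\<lambda>s. 1 / \<theta> s ^ j)" for k j by (rule \<mu>_int) measurable
  have bound: "\<exists>B. \<forall>k. (\<integral>s. 1 / \<theta> s ^ j \<partial>\<mu> k) \<le> B" for j
  proof -
    have eq: "(\<integral>s. 1 / \<theta> s ^ j \<partial>\<mu> k)
        = (1 - mass k / M) + L k (\<lambda>x. (norm x)\<^sup>2 * (1 + (norm x)\<^sup>2) ^ j) / M" for k
      by (subst \<mu>_int) (simp_all add: p_sum \<sigma> power_one_over)
    have "L k (\<lambda>x. (norm x)\<^sup>2 * (1 + (norm x)\<^sup>2) ^ j)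
        = (\<Sum>i\<in>UNIV. L k (\<lambda>x. xpow x (sq i) * (1 + (norm x)\<^sup>2) ^ j))" for k
      unfolding L_sum[symmetric] sum_distrib_right[symmetric] norm_sq[symmetric] ..
    then have "convergent (\<lambda>k. L k (\<lambda>x. (norm x)\<^sup>2 * (1 + (norm x)\<^sup>2) ^ j))"
      by (simp only:) (intro convergent_sum growth, simp add: mabs_sq)
    then obtain K where K: "\<forall>k. \<bar>L k (\<lambda>x. (norm x)\<^sup>2 * (1 + (norm x)\<^sup>2) ^ j)\<bar> \<le> K"
      by (auto dest!: convergent_imp_Bseq elim!: BseqE)
    have "(\<integral>s. 1 / \<theta> s ^ j \<partial>\<mu> k) \<le> 1 + K / M" for k
    proof -
      have "0 \<le> mass k" unfolding mass_def L_def using w by (intro sum_nonneg) auto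
      then show ?thesis
        unfolding eq using spec[OF K, of k] \<open>0 < M\<close> by (intro add_mono divide_right_mono) (auto simp: abs_le_iff)
    qed
    then show ?thesis by blast
  qed
  have bound_r: "\<exists>B. \<forall>\<^sub>F k in sequentially. (\<integral>s. 1 / \<theta> s ^ j \<partial>\<mu> (r k)) \<le> B" for j
    using bound[of j] by (auto intro: always_eventually)
  note limit = weak_limit_singular_integral[OF \<mu> P conv \<theta> pos int bound_r]
  show thesis
  proof (rule that[OF \<open>0 < M\<close> P \<theta> \<omega> limit(1,2)])
    fix \<beta> :: "'n mindex" assume \<beta>: "2 \<le> mabs \<beta>"
    define G where "G s = sqrt (\<theta> s * (1 - \<theta> s)) ^ (mabs \<beta> - 2) * xpow (\<omega> s) \<beta>" for s
    have Gc: "continuous_on UNIV G"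
      unfolding G_def xpow_def by (intro continuous_intros \<theta> \<omega>)
    have Gm [measurable]: "G \<in> borel_measurable borel"
      using Gc by (rule borel_measurable_continuous_onI)
    have G1: "\<bar>G s\<bar> \<le> 1" for s
      unfolding G_def by (rule abs_polar_le_1[OF \<theta>(2,3) \<omega>(2)])
    have eq: "(\<integral>s. G s / \<theta> s ^ (mabs \<beta> - 2) \<partial>\<mu> k) = L k (\<lambda>x. xpow x \<beta>) / M" for k
    proof -
      have "(\<integral>s. G s / \<theta> s ^ (mabs \<beta> - 2) \<partial>\<mu> k)
          = (1 - mass k / M) * (G (\<sigma> 0) / \<theta> (\<sigma> 0) ^ (mabs \<beta> - 2))
            + L k (\<lambda>x. (norm x)\<^sup>2 * (G (\<sigma> x) / \<theta> (\<sigma> x) ^ (mabs \<beta> - 2))) / M"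
        by (subst \<mu>_int) (simp_all only: p_sum, measurable)
      also have "G (\<sigma> 0) = 0" using \<beta> by (simp add: G_def \<sigma> xpow_0)
      also have "(\<lambda>x. (norm x)\<^sup>2 * (G (\<sigma> x) / \<theta> (\<sigma> x) ^ (mabs \<beta> - 2))) = (\<lambda>x. xpow x \<beta>)"
        unfolding G_def \<sigma>(3) using polar_power_identity[OF \<sigma>(2) \<beta>] by auto
      finally show ?thesis by simp
    qed
    \<comment> \<open>The integrals over \<open>\<mu> (r k)\<close> are these moments, so c \<beta>
      / M and the integral over P are limits of the same sequence.\<close>
    have "(\<lambda>k. L (r k) (\<lambda>x. xpow x \<beta>) / M) \<longlonglongrightarrow> c \<beta> / M"
      using LIMSEQ_subseq_LIMSEQ[OF Lconv[OF \<beta>] r] \<open>0 < M\<close> by (intro tendsto_intros) (auto simp: comp_def)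
    with limit(3)[OF Gc G1, of "mabs \<beta> - 2"] have "(\<integral>s. G s / \<theta> s ^ (mabs \<beta> - 2) \<partial>P) = c \<beta> / M"
      unfolding eq by (rule LIMSEQ_unique)
    then show "c \<beta> = M * (\<integral>s. sqrt (\<theta> s * (1 - \<theta> s)) ^ (mabs \<beta> - 2)
        * xpow (\<omega> s) \<beta> / \<theta> s ^ (mabs \<beta> - 2) \<partial>P)"
      using \<open>0 < M\<close> by (simp add: G_def)
  qed
qed

text \<open>By Markov's inequality the sets where |x|^2 >= 1/(n + 1) have finite measure; together
  with the null set {0} they cover the space.\<close>

lemma sigma_finite_if_norm_square_integrable:
  fixes \<nu> :: "'a::euclidean_space measure"
  assumes sets: "sets \<nu> = sets borel" and zero: "emeasure \<nu> {0} = 0"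
    and fin: "(\<integral>\<^sup>+ x. ennreal ((norm x)\<^sup>2) \<partial>\<nu>) < \<infinity>"
  shows "sigma_finite_measure \<nu>"
proof
  have space: "space \<nu> = UNIV" using sets_eq_imp_space_eq[OF sets] by simp
  define A where "A n = {x :: 'a. 1 \<le> of_nat (Suc n) * ennreal ((norm x)\<^sup>2)}" for n
  have Am: "A n \<in> sets \<nu>" for n unfolding A_def sets by measurable
  have A_fin: "emeasure \<nu> (A n) < \<infinity>" for n
  proof -
    have "(\<lambda>x :: 'a. (norm x)\<^sup>2) \<in> borel_measurable borel" by measurable
    then have meas: "(\<lambda>x :: 'a. (norm x)\<^sup>2) \<in> borel_measurable \<nu>"
      using sets measurable_cong_sets by blast
    have "UNIV \<in> sets \<nu>" using sets by simp
    then have "emeasure \<nu> {x\<in>UNIV. 1 \<le> of_nat (Suc n) * ennreal ((norm x)\<^sup>2)}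
        \<le> of_nat (Suc n) * (\<integral>\<^sup>+ x. ennreal ((norm x)\<^sup>2) * indicator UNIV x \<partial>\<nu>)"
      using meas by (intro nn_integral_Markov_inequality) auto
    also have "\<dots> < \<infinity>" using fin by (simp add: ennreal_mult_less_top of_nat_less_top)
    finally show ?thesis by (simp add: A_def)
  qed
  have "\<exists>n. x \<in> A n" if nz: "x \<noteq> 0" for x
  proof -
    obtain n where "inverse (real (Suc n)) < (norm x)\<^sup>2"
      using reals_Archimedean[of "(norm x)\<^sup>2"] nz by auto
    then have "1 \<le> real (Suc n) * (norm x)\<^sup>2" by (simp add: field_simps)
    then have "ennreal 1 \<le> ennreal (real (Suc n) * (norm x)\<^sup>2)" by (rule ennreal_leI)
    then have "x \<in> A n" by (simp add: A_def ennreal_mult ennreal_of_nat_eq_real_of_nat del: of_nat_Suc)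
    then show ?thesis by blast
  qed
  then have "\<Union> (insert {0} (range A)) = space \<nu>" unfolding space by blast
  then show "\<exists>B. countable B \<and> B \<subseteq> sets \<nu> \<and> \<Union> B = space \<nu> \<and> (\<forall>a\<in>B. emeasure \<nu> a \<noteq> \<infinity>)"
    using Am A_fin zero sets
    by (intro exI[of _ "insert {0} (range A)"]) (auto simp: less_top)
qed

lemma Levy_Khinchin_if_approximable:
  fixes c :: "('n::finite) mindex \<Rightarrow> real"
  assumes "point_mass_approximable c"
  obtains S :: "real^'n^'n" and \<nu> :: "(real^'n) measure" where "psd_matrix S"
    "sets \<nu> = sets borel" "sigma_finite_measure \<nu>" "emeasure \<nu> {0} = 0"
    "\<And>\<alpha>. 2 \<le> mabs \<alpha> \<Longrightarrow> (\<integral>\<^sup>+ x. ennreal \<bar>xpow x \<alpha>\<bar> \<partial>\<nu>) < \<infinity>"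
    "\<And>i j. c (\<lambda>k. unit_idx i k + unit_idx j k)
      = S $ i $ j + (LINT x|\<nu>. xpow x (\<lambda>k. unit_idx i k + unit_idx j k))"
    "\<And>\<alpha>. 3 \<le> mabs \<alpha> \<Longrightarrow> c \<alpha> = (LINT x|\<nu>. xpow x \<alpha>)"
proof -
  obtain M P \<theta> and \<omega> :: "real \<Rightarrow> real^'n" where "0 < M" and P: "real_distribution P"
    and \<theta>: "continuous_on UNIV \<theta>" "\<And>s. 0 \<le> \<theta> s" "\<And>s. \<theta> s \<le> 1"
    and \<omega>: "continuous_on UNIV \<omega>" "\<And>s i. \<bar>\<omega> s $ i\<bar> \<le> 1"
    and pos: "AE s in P. 0 < \<theta> s" and int: "\<And>k. integrable P (\<lambda>s. 1 / \<theta> s ^ k)"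
    and c: "\<And>\<beta>. 2 \<le> mabs \<beta> \<Longrightarrow> c \<beta> = M * (\<integral>s. sqrt (\<theta> s * (1 - \<theta> s)) ^ (mabs \<beta> - 2)
        * xpow (\<omega> s) \<beta> / \<theta> s ^ (mabs \<beta> - 2) \<partial>P)"
    by (rule polar_integral_representation[OF assms]) blast
  interpret real_distribution P by (rule P)
  have [measurable]: "\<theta> \<in> borel_measurable borel" "\<omega> \<in> borel_measurable borel"
    using \<theta>(1) \<omega>(1) by (auto intro: borel_measurable_continuous_onI)
  \<comment> \<open>\<theta> = 1 / (1 + |x|^2), so (1 - \<theta>) / \<theta> is |x|^2 and D undoes the weighting by |x|^2 / M.\<close>
  define D where "D s = (if 0 < \<theta> s \<and> \<theta> s < 1 \<and> \<omega> s \<noteq> 0 then M * \<theta> s / (1 - \<theta> s) else 0)" for s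
  define X where "X s = sqrt ((1 - \<theta> s) / \<theta> s) *\<^sub>R \<omega> s" for s
  have [measurable]: "D \<in> borel_measurable borel" unfolding D_def by measurable
  have Xm [measurable]: "X \<in> borel_measurable borel" unfolding X_def by measurable
  have D0: "0 \<le> D s" for s using \<open>0 < M\<close> by (auto simp: D_def)
  define \<nu> where "\<nu> = distr (density P (\<lambda>s. ennreal (D s))) borel X"
  define H where "H \<beta> s = sqrt (\<theta> s * (1 - \<theta> s)) ^ (mabs \<beta> - 2) * xpow (\<omega> s) \<beta> / \<theta> s ^ (mabs \<beta> - 2)"
    for \<beta> s
  \<comment> \<open>At \<open>\<theta>\<close> = 1 the density D vanishes while H keeps the factor 0
    ^ (mabs \<beta> - 2): it is 1 in order 2, which leaves the matrix term, and 0 in higher orders.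
    Where \<open>\<omega>\<close> = 0, both sides vanish since the order is positive.\<close>
  have split: "D s * xpow (X s) \<beta> = M * H \<beta> s - of_bool (mabs \<beta> = 2) * (M * (of_bool (\<theta> s = 1) * xpow (\<omega> s) \<beta>))"
    if "0 < \<theta> s" and \<beta>: "2 \<le> mabs \<beta>" for s \<beta>
  proof (cases "\<theta> s = 1")
    case True
    then show ?thesis using \<beta> by (auto simp: D_def H_def power_0_left)
  next
    case False
    with \<theta>(3)[of s] have "\<theta> s < 1" by simp
    define a where "a = (1 - \<theta> s) / \<theta> s"
    have "0 < a" using \<open>0 < \<theta> s\<close> \<open>\<theta> s < 1\<close> by (simp add: a_def)
    have "\<theta> s * (1 - \<theta> s) = a * (\<theta> s)\<^sup>2"
      using \<open>0 < \<theta> s\<close> by (simp add: a_def power2_eq_square)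
    then have "sqrt (\<theta> s * (1 - \<theta> s)) = sqrt a * \<theta> s"
      using \<open>0 < \<theta> s\<close> by (simp add: real_sqrt_mult)
    then have H: "H \<beta> s = sqrt a ^ (mabs \<beta> - 2) * xpow (\<omega> s) \<beta>"
      using \<open>0 < \<theta> s\<close> by (simp add: H_def power_mult_distrib)
    have "sqrt a ^ mabs \<beta> = sqrt a ^ (mabs \<beta> - 2) * (sqrt a)\<^sup>2"
      using \<beta> by (metis le_add_diff_inverse2 power_add)
    then have X: "xpow (X s) \<beta> = a * H \<beta> s"
      using \<open>0 < a\<close> by (simp add: X_def xpow_scaleR H flip: a_def)
    show ?thesis
    proof (cases "\<omega> s = 0")
      case True
      then show ?thesis using \<beta> False by (simp add: D_def H xpow_0)
    next
      case ne: False
      have "D s * a = M" using ne \<open>0 < \<theta> s\<close> \<open>\<theta> s < 1\<close> by (simp add: D_def a_def)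
      then have "D s * (a * H \<beta> s) = M * H \<beta> s" by (metis mult.assoc)
      then show ?thesis using False by (simp add: X)
    qed
  qed
  have Gm [measurable]: "(\<lambda>s. xpow (\<omega> s) \<beta>) \<in> borel_measurable borel"
    "(\<lambda>s. xpow (X s) \<beta>) \<in> borel_measurable borel" for \<beta>
    by (rule measurable_compose[OF _ borel_measurable_xpow], measurable)+
  have Hm [measurable]: "H \<beta> \<in> borel_measurable borel" for \<beta> unfolding H_def by measurable
  have intH: "integrable P (H \<beta>)" for \<beta>
  proof (rule Bochner_Integration.integrable_bound[OF int[of "mabs \<beta> - 2"]])
    show "H \<beta> \<in> borel_measurable P" by measurable
    have "norm (H \<beta> s) \<le> norm (1 / \<theta> s ^ (mabs \<beta> - 2))" for s
    proof -
      have "\<bar>sqrt (\<theta> s * (1 - \<theta> s)) ^ (mabs \<beta> - 2) * xpow (\<omega> s) \<beta>\<bar> \<le> 1"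
        by (rule abs_polar_le_1[OF \<theta>(2,3) \<omega>(2)])
      then have "\<bar>H \<beta> s\<bar> \<le> 1 / \<bar>\<theta> s ^ (mabs \<beta> - 2)\<bar>"
        unfolding H_def abs_divide by (rule divide_right_mono) simp
      then show ?thesis by simp
    qed
    then show "AE s in P. norm (H \<beta> s) \<le> norm (1 / \<theta> s ^ (mabs \<beta> - 2))" by simp
  qed
  have int1: "integrable P (\<lambda>s. of_bool (\<theta> s = 1) * xpow (\<omega> s) \<beta>)" for \<beta>
    by (rule integrable_const_bound[of _ 1]) (auto simp: abs_xpow_le_1 \<omega> abs_mult)
  have AE_split: "AE s in P. D s * xpow (X s) \<beta>
      = M * H \<beta> s - of_bool (mabs \<beta> = 2) * (M * (of_bool (\<theta> s = 1) * xpow (\<omega> s) \<beta>))"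
    if "2 \<le> mabs \<beta>" for \<beta>
    using pos by (rule eventually_mono) (rule split[OF _ that])
  have intD: "integrable P (\<lambda>s. D s * xpow (X s) \<beta>)" if "2 \<le> mabs \<beta>" for \<beta>
  proof -
    have "integrable P (\<lambda>s. M * H \<beta> s - of_bool (mabs \<beta> = 2) * (M * (of_bool (\<theta> s = 1) * xpow (\<omega> s) \<beta>)))"
      by (intro Bochner_Integration.integrable_diff integrable_mult_right intH int1)
    moreover have "(\<lambda>s. D s * xpow (X s) \<beta>) \<in> borel_measurable P" by measurable
    moreover have "AE s in P. M * H \<beta> s - of_bool (mabs \<beta> = 2) * (M * (of_bool (\<theta> s = 1) * xpow (\<omega> s) \<beta>))
        = D s * xpow (X s) \<beta>"
      using AE_split[OF that] by (rule eventually_mono) (rule sym)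
    ultimately show ?thesis by (rule integrable_cong_AE_imp)
  qed
  \<comment> \<open>For order 2 these are the second moments of the directions
    \<open>\<omega>\<close> carried by the mass concentrated at |x| = 0; they become the entries of
    \<open>S\<close>.\<close>
  define E where "E \<beta> = M * (\<integral>s. of_bool (\<theta> s = 1) * xpow (\<omega> s) \<beta> \<partial>P)" for \<beta>
  have moments: "c \<beta> = of_bool (mabs \<beta> = 2) * E \<beta> + (LINT x|\<nu>. xpow x \<beta>)" if "2 \<le> mabs \<beta>" for \<beta>
  proof -
    have "(LINT x|\<nu>. xpow x \<beta>) = (\<integral>s. xpow (X s) \<beta> \<partial>density P (\<lambda>s. ennreal (D s)))"
      unfolding \<nu>_def by (rule integral_distr) measurable
    also have "\<dots> = (\<integral>s. D s * xpow (X s) \<beta> \<partial>P)"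
      by (rule integral_real_density) (auto simp: D0)
    also have "\<dots> = (\<integral>s. M * H \<beta> s - of_bool (mabs \<beta> = 2) * (M * (of_bool (\<theta> s = 1) * xpow (\<omega> s) \<beta>)) \<partial>P)"
      by (rule integral_cong_AE[OF _ _ AE_split[OF that]]) measurable
    also have "\<dots> = M * integral\<^sup>L P (H \<beta>) - of_bool (mabs \<beta> = 2) * E \<beta>"
      unfolding E_def using intH[of \<beta>] int1[of \<beta>]
      by (subst Bochner_Integration.integral_diff) (auto intro!: integrable_mult_right)
    also have "M * integral\<^sup>L P (H \<beta>) = c \<beta>"
      using c[OF that] unfolding H_def[symmetric] by simp
    finally show ?thesis by simp
  qed
  have fin: "(\<integral>\<^sup>+ x. ennreal \<bar>xpow x \<beta>\<bar> \<partial>\<nu>) < \<infinity>" if "2 \<le> mabs \<beta>" for \<beta>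
  proof -
    have "(\<integral>\<^sup>+ x. ennreal \<bar>xpow x \<beta>\<bar> \<partial>\<nu>) = (\<integral>\<^sup>+ s. ennreal \<bar>xpow (X s) \<beta>\<bar> \<partial>density P (\<lambda>s. ennreal (D s)))"
      unfolding \<nu>_def by (rule nn_integral_distr) measurable
    also have "\<dots> = (\<integral>\<^sup>+ s. ennreal (D s) * ennreal \<bar>xpow (X s) \<beta>\<bar> \<partial>P)"
      by (rule nn_integral_density) measurable
    also have "\<dots> = (\<integral>\<^sup>+ s. ennreal (norm (D s * xpow (X s) \<beta>)) \<partial>P)"
      by (intro nn_integral_cong) (simp add: abs_mult D0 ennreal_mult)
    also have "\<dots> < \<infinity>" using intD[OF that] by (simp add: integrable_iff_bounded)
    finally show ?thesis .
  qed
  have zero: "emeasure \<nu> {0} = 0"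
  proof -
    have "emeasure \<nu> {0} = emeasure (density P (\<lambda>s. ennreal (D s))) (X -` {0} \<inter> space P)"
      unfolding \<nu>_def by (subst emeasure_distr) auto
    also have "\<dots> = (\<integral>\<^sup>+ s. ennreal (D s) * indicator (X -` {0} \<inter> space P) s \<partial>P)"
      by (rule emeasure_density) measurable
    \<comment> \<open>X can vanish only where \<open>\<theta>\<close> is 0 or 1 or
      \<open>\<omega>\<close> = 0, and D was set to 0 in all these cases.\<close>
    also have "\<dots> = (\<integral>\<^sup>+ s. 0 \<partial>P)"
      by (intro nn_integral_cong) (auto simp: D_def X_def indicator_def)
    finally show ?thesis by simp
  qed
  have sets: "sets \<nu> = sets borel" by (simp add: \<nu>_def)
  have "sigma_finite_measure \<nu>"
  proof (rule sigma_finite_if_norm_square_integrable[OF sets zero])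
    have "(\<integral>\<^sup>+ x. ennreal ((norm x)\<^sup>2) \<partial>\<nu>)
        = (\<integral>\<^sup>+ x. (\<Sum>i\<in>UNIV. ennreal \<bar>xpow x (\<lambda>k. unit_idx i k + unit_idx i k)\<bar>) \<partial>\<nu>)"
      by (intro nn_integral_cong) (simp add: power2_norm_eq_sum_xpow xpow_add)
    also have "\<dots> = (\<Sum>i\<in>UNIV. \<integral>\<^sup>+ x. ennreal \<bar>xpow x (\<lambda>k. unit_idx i k + unit_idx i k)\<bar> \<partial>\<nu>)"
      using sets by (intro nn_integral_sum) (simp add: measurable_cong_sets[OF sets refl])
    also have "\<dots> < \<infinity>" using fin by (simp add: mabs_add)
    finally show "(\<integral>\<^sup>+ x. ennreal ((norm x)\<^sup>2) \<partial>\<nu>) < \<infinity>" .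
  qed
  define S :: "real^'n^'n" where "S = (\<chi> i j. E (\<lambda>k. unit_idx i k + unit_idx j k))"
  have "psd_matrix S"
    unfolding psd_matrix_def
  proof (intro conjI allI)
    show "transpose S = S" by (simp add: transpose_def S_def vec_eq_iff add.commute)
    fix v
    have int2: "integrable P (\<lambda>s. v $ i * (of_bool (\<theta> s = 1) * (\<omega> s $ i * \<omega> s $ j)) * v $ j)" for i j
      using int1[of "\<lambda>k. unit_idx i k + unit_idx j k"] by (simp add: xpow_add)
    have "v \<bullet> (S *v v) = (\<Sum>i\<in>UNIV. \<Sum>j\<in>UNIV. v $ i * S $ i $ j * v $ j)"
      by (simp add: inner_vec_def matrix_vector_mult_def sum_distrib_left mult.assoc)
    also have "\<dots> = (\<Sum>i\<in>UNIV. \<Sum>j\<in>UNIV. M * (\<integral>s. v $ i * (of_bool (\<theta> s = 1) * (\<omega> s $ i * \<omega> s $ j)) * v $ j \<partial>P))"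
      by (simp add: S_def E_def xpow_add mult_ac)
    also have "\<dots> = M * (\<integral>s. (\<Sum>i\<in>UNIV. \<Sum>j\<in>UNIV. v $ i * (of_bool (\<theta> s = 1) * (\<omega> s $ i * \<omega> s $ j)) * v $ j) \<partial>P)"
      using int2 by (simp add: Bochner_Integration.integral_sum Bochner_Integration.integrable_sum sum_distrib_left)
    \<comment> \<open>The quadratic form of a second moment matrix is the integral of a
      square.\<close>
    also have "\<dots> = M * (\<integral>s. of_bool (\<theta> s = 1) * (v \<bullet> \<omega> s)\<^sup>2 \<partial>P)"
      by (simp add: inner_vec_def power2_eq_square sum_product sum_distrib_left mult_ac)
    also have "0 \<le> \<dots>" using \<open>0 < M\<close> by (intro mult_nonneg_nonneg Bochner_Integration.integral_nonneg) auto
    finally show "0 \<le> v \<bullet> (S *v v)" .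
  qed
  show thesis
    by (rule that[OF \<open>psd_matrix S\<close> sets \<open>sigma_finite_measure \<nu>\<close> zero fin])
      (use moments in \<open>auto simp: S_def mabs_add\<close>)
qed

theorem mainTheorem8:
  fixes c :: "('n::finite) mindex \<Rightarrow> real"
  shows "(\<forall>t\<ge>0. positivity_preserver (exp_op c t)) \<longleftrightarrow>
    (\<exists>(b::real^'n) (S::real^'n^'n) (\<nu>::(real^'n) measure).
       psd_matrix S \<and>
       sets \<nu> = sets borel \<and> sigma_finite_measure \<nu> \<and> emeasure \<nu> {0} = 0 \<and>
       (\<forall>\<alpha>. mabs \<alpha> \<ge> 2 \<longrightarrow> (\<integral>\<^sup>+ x. ennreal \<bar>xpow x \<alpha>\<bar> \<partial>\<nu>) < \<infinity>) \<and>
       (\<forall>i. c (unit_idx i) = b $ i + (LINT x:{x. norm x \<ge> 1}|\<nu>. x $ i)) \<and>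
       (\<forall>i j. c ((\<lambda>k. unit_idx i k + unit_idx j k)) = S $ i $ j + (LINT x|\<nu>. xpow x ((\<lambda>k. unit_idx i k + unit_idx j k)))) \<and>
       (\<forall>\<alpha>. mabs \<alpha> \<ge> 3 \<longrightarrow> c \<alpha> = (LINT x|\<nu>. xpow x \<alpha>)))"
  (is "?preserving \<longleftrightarrow> ?Levy_Khinchin")
proof
  assume ?preserving
  then have "point_mass_approximable c"
    by (intro approximable_if_cond_positive cond_positive_if_positivity_preserver) blast
  then obtain S :: "real^'n^'n" and \<nu> :: "(real^'n) measure" where *: "psd_matrix S"
    "sets \<nu> = sets borel" "sigma_finite_measure \<nu>" "emeasure \<nu> {0} = 0"
    "\<And>\<alpha>. 2 \<le> mabs \<alpha> \<Longrightarrow> (\<integral>\<^sup>+ x. ennreal \<bar>xpow x \<alpha>\<bar> \<partial>\<nu>) < \<infinity>"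
    "\<And>i j. c (\<lambda>k. unit_idx i k + unit_idx j k)
      = S $ i $ j + (LINT x|\<nu>. xpow x (\<lambda>k. unit_idx i k + unit_idx j k))"
    "\<And>\<alpha>. 3 \<le> mabs \<alpha> \<Longrightarrow> c \<alpha> = (LINT x|\<nu>. xpow x \<alpha>)"
    by (rule Levy_Khinchin_if_approximable) blast
  \<comment> \<open>The first-order coefficients are unconstrained: b is whatever remains after
    subtracting the truncated integral.\<close>
  show ?Levy_Khinchin
    by (intro exI[of _ "\<chi> i. c (unit_idx i) - (LINT x:{x. norm x \<ge> 1}|\<nu>. x $ i)"]
        exI[of _ S] exI[of _ \<nu>] conjI allI impI *) auto
next
  assume ?Levy_Khinchin
  then have "cond_positive c" by (elim exE conjE) (rule cond_positive_if_Levy_Khinchin; blast)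
  then show ?preserving
    using approximable_if_cond_positive positivity_preserver_if_approximable by blast
qed

end
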